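(* Let $n\ge 1$, let $a$ and $b$ be non-zero elements of $\mathbb{C}_n^\perp\subset A_n$, and suppose that $\{a,b\}\in A_{n+1}$ belongs to the $D$-locus. Then $\mathrm{Ann}\{a,b\}$ is the $\mathbb{C}$-orthogonal direct sum of: (1) the space of all elements $\{x,y\}$ such that $x$ belongs to $\mathrm{Ann}(a)$ and $y$ belongs to $\mathrm{Ann}(b)$; (2) the $\mathbb{C}_{n+1}$-linear span of the element $\big\{|b|^2a,\,-|a|^2b\big\}$; (3) the $\mathbb{C}_{n+1}$-linear span of the element $\big\{\tfrac{b}{a},\,-\tfrac{a}{b}\big\}+\sqrt2\,(0,i_n)$. In particular, $\dim\mathrm{Ann}\{a,b\}=\dim\mathrm{Ann}(a)+\dim\mathrm{Ann}(b)+4$.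
   Context: The Cayley-Dickson algebras $A_n$ are real algebras with involution defined inductively: $A_0=\mathbb{R}$ with trivial conjugation, and $A_n=A_{n-1}\times A_{n-1}$ additively, with $(a,b)^*=(a^*,-b)$ and $(a,b)(c,d)=(ac-d^*b,\;da+bc^* )$. For $n\ge 1$ put $i_n=(0,1)\in A_n$, and let $\mathbb{C}_n$ be the $\mathbb{R}$-linear span of $1=(1,0)$ and $i_n$ (a subalgebra isomorphic to $\mathbb{C}$); left multiplication makes $A_n$ a $\mathbb{C}_n$-vector space. The real inner product is $\langle a,b\rangle_{\mathbb{R}}=\mathrm{Re}(ab^* )$, where $\mathrm{Re}(x)=\frac12(x+x^* )$, with norm $|a|=\sqrt{aa^*}$; "orthogonal" refers to it. The Hermitian inner product $\langle a,b\rangle_{\mathbb{C}}$ on $A_n$ is the orthogonal projection of $ab^*$ onto $\mathbb{C}_n$ (and similarly on $A_{n+1}$ with $\mathbb{C}_{n+1}$); $a,b$ are $\mathbb{C}$-orthogonal if $\langle a,b\rangle_{\mathbb{C}}=0$. $\mathbb{C}_n^\perp$ is the orthogonal complement of $\mathbb{C}_n$ in $A_n$. For $a,b\in\mathbb{C}_n^\perp$, $\{a,b\}$ denotes the element $\frac{1}{\sqrt2}\big(a+b,\;i_n(-a+b)\big)$ of $A_{n+1}$. For $x\in A_m$, $\mathrm{Ann}(x)=\{y\in A_m: xy=0\}$; dimensions are over $\mathbb{R}$. The $D$-locus in $A_{n+1}$ is the space of all elements $\{a,b\}$ with $a,b\in\mathbb{C}_n^\perp$ such that (1) $a$ and $b$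 are $\mathbb{C}$-orthogonal, (2) $a$ is orthogonal to $\mathrm{Ann}(b)$, and (3) $b$ is orthogonal to $\mathrm{Ann}(a)$ (annihilators taken in $A_n$). If $b$ is orthogonal to $\mathrm{Ann}(a)$, then $\frac{b}{a}$ denotes the unique element of $A_n$ such that $a\cdot\frac{b}{a}=b$ and $\frac{b}{a}$ is orthogonal to $\mathrm{Ann}(a)$; likewise $\frac{a}{b}$ with the roles of $a$ and $b$ exchanged. (When $\{a,b\}$ is in the $D$-locus, both exist and belong to $\mathbb{C}_n^\perp$.) *)

theory Defs
  imports "HOL-Analysis.Analysis" "HOL-Analysis.Finite_Function_Topology"
begin

text \<open>
  All the algebras A_n live in one real vector space: an element of A_n is a finitely supported
  real sequence with support in {0, ..., 2^n - 1}, and the pair (a, b) in A_{n+1} of a, b in A_n is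
  the concatenation of the 2^n coordinates of a and the 2^n coordinates of b. Under this encoding
  addition, scaling, span and dimension are those of the ambient type. The algebra multiplication
  is \<open>cd_mult\<close>; it has nothing to do with the convolution product of finitely supported functions.
\<close>

type_synonym cd = "nat \<Rightarrow>\<^sub>0 real"

definition cd_carrier :: "nat \<Rightarrow> cd set" where
  "cd_carrier n = {x. Poly_Mapping.keys x \<subseteq> {..<2 ^ n}}"

definition cd_pair :: "nat \<Rightarrow> cd \<Rightarrow> cd \<Rightarrow> cd" where
  "cd_pair n a b =
     (\<Sum>k<2 ^ n. Poly_Mapping.single k (Poly_Mapping.lookup a k)) +
     (\<Sum>k<2 ^ n. Poly_Mapping.single (2 ^ n + k) (Poly_Mapping.lookup b k))"

definition cd_fst :: "nat \<Rightarrow> cd \<Rightarrow> cd" where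
  "cd_fst n x = (\<Sum>k<2 ^ n. Poly_Mapping.single k (Poly_Mapping.lookup x k))"

definition cd_snd :: "nat \<Rightarrow> cd \<Rightarrow> cd" where
  "cd_snd n x = (\<Sum>k<2 ^ n. Poly_Mapping.single k (Poly_Mapping.lookup x (2 ^ n + k)))"

lemma lookup_cd_block:
  "Poly_Mapping.lookup (\<Sum>k<N. Poly_Mapping.single (M + k) (f k)) j =
     (if M \<le> j \<and> j < M + N then f (j - M) else (0::real))" for M N :: nat
  by (induction N) (auto simp: lookup_add lookup_single when_def)

lemma lookup_cd_pair:
  "Poly_Mapping.lookup (cd_pair n a b) j =
     (if j < 2 ^ n then Poly_Mapping.lookup a j
      else if j < 2 ^ Suc n then Poly_Mapping.lookup b (j - 2 ^ n) else 0)"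
  using lookup_cd_block[of 0 "Poly_Mapping.lookup a" "2 ^ n" j]
    lookup_cd_block[of "2 ^ n" "Poly_Mapping.lookup b" "2 ^ n" j]
  by (simp add: cd_pair_def lookup_add)

lemma lookup_cd_fst:
  "Poly_Mapping.lookup (cd_fst n x) j = (if j < 2 ^ n then Poly_Mapping.lookup x j else 0)"
  using lookup_cd_block[of 0 "Poly_Mapping.lookup x" "2 ^ n" j] by (simp add: cd_fst_def)

lemma lookup_cd_snd:
  "Poly_Mapping.lookup (cd_snd n x) j =
     (if j < 2 ^ n then Poly_Mapping.lookup x (2 ^ n + j) else 0)"
  using lookup_cd_block[of 0 "\<lambda>k. Poly_Mapping.lookup x (2 ^ n + k)" "2 ^ n" j]
  by (simp add: cd_snd_def)

lemma cd_carrier_iff: "x \<in> cd_carrier n \<longleftrightarrow> (\<forall>j\<ge>2 ^ n. Poly_Mapping.lookup x j = 0)"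
  by (auto simp: cd_carrier_def in_keys_iff not_less[symmetric] subset_iff)

lemma cd_fst_in_carrier: "cd_fst n x \<in> cd_carrier n"
  and cd_snd_in_carrier: "cd_snd n x \<in> cd_carrier n"
  and cd_pair_in_carrier: "cd_pair n a b \<in> cd_carrier (Suc n)"
  by (simp_all add: cd_carrier_iff lookup_cd_fst lookup_cd_snd lookup_cd_pair)

lemma cd_fst_pair: "a \<in> cd_carrier n \<Longrightarrow> cd_fst n (cd_pair n a b) = a"
  and cd_snd_pair: "b \<in> cd_carrier n \<Longrightarrow> cd_snd n (cd_pair n a b) = b"
  by (auto intro!: poly_mapping_eqI
      simp: cd_carrier_iff lookup_cd_fst lookup_cd_snd lookup_cd_pair not_less)

lemma cd_pair_fst_snd: "x \<in> cd_carrier (Suc n) \<Longrightarrow> cd_pair n (cd_fst n x) (cd_snd n x) = x"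
  by (auto intro!: poly_mapping_eqI
      simp: cd_carrier_iff lookup_cd_fst lookup_cd_snd lookup_cd_pair not_less)

primrec cd_conj :: "nat \<Rightarrow> cd \<Rightarrow> cd" where
  "cd_conj 0 x = x"
| "cd_conj (Suc n) x = cd_pair n (cd_conj n (cd_fst n x)) (- cd_snd n x)"

primrec cd_mult :: "nat \<Rightarrow> cd \<Rightarrow> cd \<Rightarrow> cd" where
  "cd_mult 0 x y = Poly_Mapping.single 0 (Poly_Mapping.lookup x 0 * Poly_Mapping.lookup y 0)"
| "cd_mult (Suc n) x y =
     (let a = cd_fst n x; b = cd_snd n x; c = cd_fst n y; d = cd_snd n y
      in cd_pair n (cd_mult n a c - cd_mult n (cd_conj n d) b)
                   (cd_mult n d a + cd_mult n b (cd_conj n c)))"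

definition cd_one :: cd where
  "cd_one = Poly_Mapping.single 0 1"

text \<open>Only meaningful for \<open>n \<ge> 1\<close>, as are the notions below that are built on it.\<close>

definition cd_i :: "nat \<Rightarrow> cd" where
  "cd_i n = cd_pair (n - 1) 0 cd_one"

definition cd_C :: "nat \<Rightarrow> cd set" where
  "cd_C n = span {cd_one, cd_i n}"

definition cd_Re :: "nat \<Rightarrow> cd \<Rightarrow> cd" where
  "cd_Re n x = (1 / 2) *\<^sub>R (x + cd_conj n x)"

text \<open>
  Both Re(x) and a a* are real multiples of 1; the corresponding real number is the coordinate
  at position 0.
\<close>

definition cd_inner :: "nat \<Rightarrow> cd \<Rightarrow> cd \<Rightarrow> real" where
  "cd_inner n a b = Poly_Mapping.lookup (cd_Re n (cd_mult n a (cd_conj n b))) 0"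

definition cd_norm :: "nat \<Rightarrow> cd \<Rightarrow> real" where
  "cd_norm n a = sqrt (Poly_Mapping.lookup (cd_mult n a (cd_conj n a)) 0)"

definition cd_orth_to :: "nat \<Rightarrow> cd \<Rightarrow> cd set \<Rightarrow> bool" where
  "cd_orth_to n a S \<longleftrightarrow> (\<forall>y\<in>S. cd_inner n a y = 0)"

definition cd_proj_C :: "nat \<Rightarrow> cd \<Rightarrow> cd" where
  "cd_proj_C n x = (THE p. p \<in> cd_C n \<and> cd_orth_to n (x - p) (cd_C n))"

definition cd_herm :: "nat \<Rightarrow> cd \<Rightarrow> cd \<Rightarrow> cd" where
  "cd_herm n a b = cd_proj_C n (cd_mult n a (cd_conj n b))"

definition cd_C_perp :: "nat \<Rightarrow> cd set" where
  "cd_C_perp n = {a \<in> cd_carrier n. cd_orth_to n a (cd_C n)}"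

text \<open>The element {a, b} of A_{n+1}, for a, b in A_n.\<close>

definition cd_brace :: "nat \<Rightarrow> cd \<Rightarrow> cd \<Rightarrow> cd" where
  "cd_brace n a b = (1 / sqrt 2) *\<^sub>R cd_pair n (a + b) (cd_mult n (cd_i n) (- a + b))"

definition cd_Ann :: "nat \<Rightarrow> cd \<Rightarrow> cd set" where
  "cd_Ann n x = {y \<in> cd_carrier n. cd_mult n x y = 0}"

text \<open>The D-locus in A_{n+1}.\<close>

definition cd_D_locus :: "nat \<Rightarrow> cd set" where
  "cd_D_locus n = {cd_brace n a b | a b.
     a \<in> cd_C_perp n \<and> b \<in> cd_C_perp n \<and> cd_herm n a b = 0 \<and>
     cd_orth_to n a (cd_Ann n b) \<and> cd_orth_to n b (cd_Ann n a)}"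

text \<open>\<open>cd_quot n b a\<close> is b/a; it is determined when b is orthogonal to Ann(a).\<close>

definition cd_quot :: "nat \<Rightarrow> cd \<Rightarrow> cd \<Rightarrow> cd" where
  "cd_quot n b a =
     (THE q. q \<in> cd_carrier n \<and> cd_mult n a q = b \<and> cd_orth_to n q (cd_Ann n a))"

definition cd_C_subspace :: "nat \<Rightarrow> cd set \<Rightarrow> bool" where
  "cd_C_subspace n V \<longleftrightarrow>
     V \<subseteq> cd_carrier n \<and> subspace V \<and> (\<forall>c\<in>cd_C n. \<forall>x\<in>V. cd_mult n c x \<in> V)"

definition cd_C_span1 :: "nat \<Rightarrow> cd \<Rightarrow> cd set" where
  "cd_C_span1 n v = {cd_mult n c v | c. c \<in> cd_C n}"

definition cd_C_orthogonal :: "nat \<Rightarrow> cd set \<Rightarrow> cd set \<Rightarrow> bool" where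
  "cd_C_orthogonal n V W \<longleftrightarrow> (\<forall>x\<in>V. \<forall>y\<in>W. cd_herm n x y = 0)"

definition cd_C_orth_direct_sum ::
  "nat \<Rightarrow> cd set \<Rightarrow> cd set \<Rightarrow> cd set \<Rightarrow> cd set \<Rightarrow> bool" where
  "cd_C_orth_direct_sum n U V1 V2 V3 \<longleftrightarrow>
     cd_C_subspace n V1 \<and> cd_C_subspace n V2 \<and> cd_C_subspace n V3 \<and>
     cd_C_orthogonal n V1 V2 \<and> cd_C_orthogonal n V1 V3 \<and> cd_C_orthogonal n V2 V3 \<and>
     bij_betw (\<lambda>(x, y, z). x + y + z) (V1 \<times> V2 \<times> V3) U"

end

theory Submission
  imports Defs
begin

text \<open>
  For u, v in C_n^perp write uv = P(u,v) - h(u,v), where h is the Hermitian product and P(u,v) is the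
  component in C_n^perp. Then P is antisymmetric and conjugate linear in both arguments, and
  P(u,v) is C-orthogonal to u. Every element of A_{n+1} is uniquely {x,y} + (alpha, beta) with
  alpha, beta in C_n; in these coordinates {a,b}{x,y} has brace component
  sqrt 2 {P(a,x), P(b,y)} and an explicit C_n-component built from h, and {a,b}(alpha, beta) is a
  brace {u,v} with u, v in the C_n-span of a and b. If the product of {a,b} with {x,y} + (alpha, beta)
  vanishes, pairing its first brace component with a shows that alpha and beta are real multiples of
  i_n, so that (alpha, beta) is the part outside the braces of a C_{n+1}-multiple of the third
  generator. Subtracting this multiple leaves {x,y} with P(a,x) = P(b,y) = 0; subtracting a multiple of
  the second generator then makes h(a,x), and with it h(b,y), vanish, so x and y annihilate a and b.
\<close>

section \<open>Arithmetic of the Cayley-Dickson algebras\<close>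

text \<open>A_n is not associative and, from n = 4 on, has zero divisors, so products can be neither
  regrouped nor cancelled. Two substitutes carry the proof: multiplication by x and by x* are
  adjoint for the real inner product, and left multiplication by i_n squares to -1 and satisfies
  (i_n u)v = -i_n(uv) modulo C_n on C_n^perp. Complex statements are split into real ones: h(u,v) is
  recorded by the two numbers <u,v> and <u, i_n v>. The D-locus conditions enter at three places.
  C-orthogonality of a and b removes the cross terms when the second generator is multiplied by
  {a,b}, and separates the C_n-coordinates of an annihilating element. Orthogonality to the
  annihilators makes the quotients b/a and a/b exist. It also makes Ann(a) C-orthogonal to b and
  Ann(b) C-orthogonal to a, without which the first summand would not annihilate {a,b}. The ambient
  vector space is infinite-dimensional, so rank arguments are made inside the finitely spanned
  carriers.\<close>

lemma lookup_scaleR: "Poly_Mapping.lookup (c *\<^sub>R x) j = c *\<^sub>R Poly_Mapping.lookup x j"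
  for x :: "'a \<Rightarrow>\<^sub>0 'b::real_vector"
proof -
  have "finite {i. c *\<^sub>R Poly_Mapping.lookup x i \<noteq> 0}"
    by (rule finite_subset[OF _ finite_lookup[of x]]) auto
  then show ?thesis
    by (simp add: scaleR_poly_mapping_def Abs_poly_mapping_inverse)
qed

lemmas lookup_cd =
  lookup_add lookup_minus lookup_uminus lookup_scaleR lookup_cd_pair lookup_cd_fst lookup_cd_snd

lemma cd_carrier_closed [simp, intro]:
  "0 \<in> cd_carrier n"
  "x \<in> cd_carrier n \<Longrightarrow> y \<in> cd_carrier n \<Longrightarrow> x + y \<in> cd_carrier n"
  "x \<in> cd_carrier n \<Longrightarrow> y \<in> cd_carrier n \<Longrightarrow> x - y \<in> cd_carrier n"
  "x \<in> cd_carrier n \<Longrightarrow> - x \<in> cd_carrier n"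
  "x \<in> cd_carrier n \<Longrightarrow> c *\<^sub>R x \<in> cd_carrier n"
  by (auto simp: cd_carrier_iff lookup_cd)

lemma cd_fst_linear [simp]:
  "cd_fst n 0 = 0"
  "cd_fst n (x + y) = cd_fst n x + cd_fst n y"
  "cd_fst n (x - y) = cd_fst n x - cd_fst n y"
  "cd_fst n (- x) = - cd_fst n x"
  "cd_fst n (c *\<^sub>R x) = c *\<^sub>R cd_fst n x"
  by (auto intro!: poly_mapping_eqI simp: lookup_cd)

lemma cd_snd_linear [simp]:
  "cd_snd n 0 = 0"
  "cd_snd n (x + y) = cd_snd n x + cd_snd n y"
  "cd_snd n (x - y) = cd_snd n x - cd_snd n y"
  "cd_snd n (- x) = - cd_snd n x"
  "cd_snd n (c *\<^sub>R x) = c *\<^sub>R cd_snd n x"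
  by (auto intro!: poly_mapping_eqI simp: lookup_cd)

text \<open>Linearity is joint in the two components. The rules are kept out of the simpset because
  they mostly serve from right to left, to merge several pairs into one.\<close>

lemma cd_pair_linear:
  "cd_pair n 0 0 = 0"
  "cd_pair n (a + c) (b + d) = cd_pair n a b + cd_pair n c d"
  "cd_pair n (a - c) (b - d) = cd_pair n a b - cd_pair n c d"
  "cd_pair n (- a) (- b) = - cd_pair n a b"
  "cd_pair n (r *\<^sub>R a) (r *\<^sub>R b) = r *\<^sub>R cd_pair n a b"
  by (auto intro!: poly_mapping_eqI simp: lookup_cd)

lemma cd_mult_carrier [simp, intro]: "cd_mult n x y \<in> cd_carrier n"
  by (cases n) (auto simp: Let_def cd_pair_in_carrier cd_carrier_iff[of _ 0] lookup_single when_def)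

lemma cd_conj_carrier [simp, intro]: "x \<in> cd_carrier n \<Longrightarrow> cd_conj n x \<in> cd_carrier n"
  by (cases n) (auto simp: cd_pair_in_carrier)

lemma cd_one_carrier [simp, intro]: "cd_one \<in> cd_carrier n"
  by (auto simp: cd_one_def cd_carrier_iff lookup_one when_def)

lemma cd_conj_linear [simp]:
  "cd_conj n 0 = 0"
  "cd_conj n (x + y) = cd_conj n x + cd_conj n y"
  "cd_conj n (x - y) = cd_conj n x - cd_conj n y"
  "cd_conj n (- x) = - cd_conj n x"
  "cd_conj n (c *\<^sub>R x) = c *\<^sub>R cd_conj n x"
proof -
  have *: "linear (cd_conj n)"
  proof (induction n)
    case 0
    then show ?case by (simp add: linear_iff)
  next
    case (Suc n)
    interpret linear "cd_conj n" by (fact Suc)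
    show ?case
      by (simp add: linear_iff add scale minus_add_distrib cd_pair_linear(2,5)[symmetric])
  qed
  then show "cd_conj n 0 = 0" "cd_conj n (x + y) = cd_conj n x + cd_conj n y"
    "cd_conj n (x - y) = cd_conj n x - cd_conj n y" "cd_conj n (- x) = - cd_conj n x"
    "cd_conj n (c *\<^sub>R x) = c *\<^sub>R cd_conj n x"
    by (simp_all add: linear_0 linear_add linear_diff linear_neg linear_scale)
qed

lemma bilinear_cd_mult: "bilinear (cd_mult n)"
proof (induction n)
  case 0
  show ?case
    unfolding bilinear_def linear_iff
    by (auto intro!: poly_mapping_eqI simp: lookup_cd lookup_single when_def algebra_simps)
next
  case (Suc n)
  note b = bilinear_ladd[OF Suc] bilinear_radd[OF Suc] bilinear_lmul[OF Suc] bilinear_rmul[OF Suc]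
  show ?case
    unfolding bilinear_def linear_iff
    by (simp add: b Let_def cd_pair_linear(2,5)[symmetric] scaleR_add_right[symmetric]
         scaleR_diff_right[symmetric])
      (simp add: algebra_simps)
qed

lemmas cd_mult_bilinear [simp] =
  bilinear_ladd[OF bilinear_cd_mult] bilinear_radd[OF bilinear_cd_mult]
  bilinear_lsub[OF bilinear_cd_mult] bilinear_rsub[OF bilinear_cd_mult]
  bilinear_lneg[OF bilinear_cd_mult] bilinear_rneg[OF bilinear_cd_mult]
  bilinear_lzero[OF bilinear_cd_mult] bilinear_rzero[OF bilinear_cd_mult]
  bilinear_lmul[OF bilinear_cd_mult] bilinear_rmul[OF bilinear_cd_mult]

declare cd_mult.simps(2) [simp del] cd_conj.simps(2) [simp del]

lemma cd_mult_pair: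
  assumes "a \<in> cd_carrier n" "b \<in> cd_carrier n" "c \<in> cd_carrier n" "d \<in> cd_carrier n"
  shows "cd_mult (Suc n) (cd_pair n a b) (cd_pair n c d) =
    cd_pair n (cd_mult n a c - cd_mult n (cd_conj n d) b)
              (cd_mult n d a + cd_mult n b (cd_conj n c))"
  using assms by (simp add: cd_mult.simps(2) cd_fst_pair cd_snd_pair Let_def)

lemma cd_conj_pair:
  assumes "a \<in> cd_carrier n" "b \<in> cd_carrier n"
  shows "cd_conj (Suc n) (cd_pair n a b) = cd_pair n (cd_conj n a) (- b)"
  using assms by (simp add: cd_conj.simps(2) cd_fst_pair cd_snd_pair)

lemma cd_carrier_SucE:
  assumes "x \<in> cd_carrier (Suc n)"
  obtains a b where "x = cd_pair n a b" "a \<in> cd_carrier n" "b \<in> cd_carrier n"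
  using assms cd_pair_fst_snd cd_fst_in_carrier cd_snd_in_carrier by metis

lemma cd_conj_conj [simp]: "x \<in> cd_carrier n \<Longrightarrow> cd_conj n (cd_conj n x) = x"
proof (induction n arbitrary: x)
  case 0
  then show ?case by simp
next
  case (Suc n)
  from Suc.prems obtain a b where "x = cd_pair n a b" "a \<in> cd_carrier n" "b \<in> cd_carrier n"
    by (rule cd_carrier_SucE)
  then show ?case by (simp add: cd_conj_pair Suc.IH)
qed

lemma cd_conj_mult:
  assumes "x \<in> cd_carrier n" "y \<in> cd_carrier n"
  shows "cd_conj n (cd_mult n x y) = cd_mult n (cd_conj n y) (cd_conj n x)"
  using assms
proof (induction n arbitrary: x y)
  case 0
  then show ?case by (simp add: mult.commute)
next
  case (Suc n)
  from Suc.prems obtain a b c d where "x = cd_pair n a b" "a \<in> cd_carrier n" "b \<in> cd_carrier n"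
    "y = cd_pair n c d" "c \<in> cd_carrier n" "d \<in> cd_carrier n"
    by (metis cd_carrier_SucE)
  then show ?case
    by (simp add: cd_conj_pair cd_mult_pair Suc.IH algebra_simps)
qed

text \<open>Under the encoding A_n sits inside A_{n+1} by literal inclusion, so one element
  \<open>cd_one\<close> is the unit at every level. As a rewrite rule from left to right this
  equation would loop.\<close>

lemma cd_one_Suc: "cd_one = cd_pair n cd_one 0"
  by (auto intro!: poly_mapping_eqI simp: lookup_cd cd_one_def lookup_one when_def)

lemma cd_pair_one: "cd_pair n (r *\<^sub>R cd_one) 0 = r *\<^sub>R cd_one"
  by (metis cd_one_Suc cd_pair_linear(5) scaleR_zero_right)

lemma cd_conj_one [simp]: "cd_conj n cd_one = cd_one"
proof (induction n)
  case (Suc n)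
  then have "cd_conj (Suc n) (cd_pair n cd_one 0) = cd_pair n cd_one 0"
    by (simp add: cd_conj_pair)
  then show ?case
    by (simp only: cd_one_Suc[of n, symmetric])
qed simp

lemma cd_mult_one [simp]:
  assumes "x \<in> cd_carrier n"
  shows "cd_mult n cd_one x = x" and "cd_mult n x cd_one = x"
proof -
  have "cd_mult n cd_one x = x \<and> cd_mult n x cd_one = x"
    using assms
  proof (induction n arbitrary: x)
    case 0
    then show ?case
      by (auto intro!: poly_mapping_eqI simp: cd_one_def lookup_single when_def cd_carrier_iff)
  next
    case (Suc n)
    from Suc.prems obtain a b where "x = cd_pair n a b" "a \<in> cd_carrier n" "b \<in> cd_carrier n"
      by (rule cd_carrier_SucE)
    then have "cd_mult (Suc n) (cd_pair n cd_one 0) x = x \<and> cd_mult (Suc n) x (cd_pair n cd_one 0) = x"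
      using Suc.IH by (simp add: cd_mult_pair)
    then show ?case
      by (simp only: cd_one_Suc[of n, symmetric])
  qed
  then show "cd_mult n cd_one x = x" and "cd_mult n x cd_one = x" by auto
qed

lemma sum_cd_pair:
  "(\<Sum>k<2 ^ Suc n. Poly_Mapping.lookup (cd_pair n a b) k * Poly_Mapping.lookup (cd_pair n c d) k) =
   (\<Sum>k<2 ^ n. Poly_Mapping.lookup a k * Poly_Mapping.lookup c k) +
   (\<Sum>k<2 ^ n. Poly_Mapping.lookup b k * Poly_Mapping.lookup d k)"
proof -
  have *: "(\<Sum>k<m + l. f k) = (\<Sum>k<m. f k) + (\<Sum>k<l. f (m + k))"
    for f :: "nat \<Rightarrow> real" and m l
    by (induction l) auto
  show ?thesis
    unfolding power_Suc mult_2 * by (simp add: lookup_cd_pair)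
qed

text \<open>The norm identity x x* = |x|^2 is polarized from the start, so that both the inner product
  and the anticommutation of orthogonal imaginary elements come out of one induction.\<close>

lemma cd_mult_conj_polarized:
  fixes x y :: cd
  assumes "x \<in> cd_carrier n" "y \<in> cd_carrier n"
  defines "S \<equiv> (\<Sum>k<2 ^ n. Poly_Mapping.lookup x k * Poly_Mapping.lookup y k)"
  shows "Poly_Mapping.lookup (cd_mult n x (cd_conj n y)) 0 = S"
    and "Poly_Mapping.lookup (cd_mult n (cd_conj n x) y) 0 = S"
    and "cd_mult n x (cd_conj n y) + cd_mult n y (cd_conj n x) = (2 * S) *\<^sub>R cd_one"
    and "cd_mult n (cd_conj n x) y + cd_mult n (cd_conj n y) x = (2 * S) *\<^sub>R cd_one"
proof -
  have "Poly_Mapping.lookup (cd_mult n x (cd_conj n y)) 0 = S \<and>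
      Poly_Mapping.lookup (cd_mult n (cd_conj n x) y) 0 = S \<and>
      cd_mult n x (cd_conj n y) + cd_mult n y (cd_conj n x) = (2 * S) *\<^sub>R cd_one \<and>
      cd_mult n (cd_conj n x) y + cd_mult n (cd_conj n y) x = (2 * S) *\<^sub>R cd_one"
    using assms(1,2) unfolding S_def
  proof (induction n arbitrary: x y)
    case 0
    then show ?case
      by (auto intro!: poly_mapping_eqI simp: lookup_cd lookup_single when_def cd_one_def lookup_one)
  next
    case (Suc n)
    from Suc.prems obtain a b c d where xy: "x = cd_pair n a b" "a \<in> cd_carrier n"
      "b \<in> cd_carrier n" "y = cd_pair n c d" "c \<in> cd_carrier n" "d \<in> cd_carrier n"
      by (metis cd_carrier_SucE)
    \<comment> \<open>The first component of xy* is ac* + d*b, so the hypothesis is needed for b and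
      d in both orders. The second components of xy* and yx* cancel.\<close>
    note IH = Suc.IH[OF xy(2,5)] Suc.IH[OF xy(3,6)] Suc.IH[OF xy(6,3)]
    have 1: "cd_mult n a (cd_conj n c) + cd_mult n (cd_conj n d) b +
        (cd_mult n c (cd_conj n a) + cd_mult n (cd_conj n b) d) =
        (2 * ((\<Sum>k<2 ^ n. Poly_Mapping.lookup a k * Poly_Mapping.lookup c k) +
          (\<Sum>k<2 ^ n. Poly_Mapping.lookup b k * Poly_Mapping.lookup d k))) *\<^sub>R cd_one"
      (is "?l = _")
    proof -
      have "?l = (cd_mult n a (cd_conj n c) + cd_mult n c (cd_conj n a)) +
          (cd_mult n (cd_conj n b) d + cd_mult n (cd_conj n d) b)"
        by (simp only: ac_simps)
      then show ?thesis using IH by (simp only: distrib_left scaleR_add_left)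
    qed
    have 2: "cd_mult n (cd_conj n a) c + cd_mult n (cd_conj n d) b +
        (cd_mult n (cd_conj n c) a + cd_mult n (cd_conj n b) d) =
        (2 * ((\<Sum>k<2 ^ n. Poly_Mapping.lookup a k * Poly_Mapping.lookup c k) +
          (\<Sum>k<2 ^ n. Poly_Mapping.lookup b k * Poly_Mapping.lookup d k))) *\<^sub>R cd_one"
      (is "?l = _")
    proof -
      have "?l = (cd_mult n (cd_conj n a) c + cd_mult n (cd_conj n c) a) +
          (cd_mult n (cd_conj n b) d + cd_mult n (cd_conj n d) b)"
        by (simp only: ac_simps)
      then show ?thesis using IH by (simp only: distrib_left scaleR_add_left)
    qed
    show ?case
      unfolding xy sum_cd_pair using xy(2,3,5,6) IH 1 2
      by (simp add: cd_conj_pair cd_mult_pair lookup_cd_pair lookup_add cd_pair_one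
          cd_pair_linear(2)[symmetric] mult.commute[of "Poly_Mapping.lookup d _"])
  qed
  then show "Poly_Mapping.lookup (cd_mult n x (cd_conj n y)) 0 = S"
    and "Poly_Mapping.lookup (cd_mult n (cd_conj n x) y) 0 = S"
    and "cd_mult n x (cd_conj n y) + cd_mult n y (cd_conj n x) = (2 * S) *\<^sub>R cd_one"
    and "cd_mult n (cd_conj n x) y + cd_mult n (cd_conj n y) x = (2 * S) *\<^sub>R cd_one"
    by auto
qed

section \<open>Inner product and the subalgebra of complex numbers\<close>

lemma lookup_cd_conj_0: "Poly_Mapping.lookup (cd_conj n x) 0 = Poly_Mapping.lookup x 0"
  by (induction n arbitrary: x) (auto simp: cd_conj.simps(2) lookup_cd)

lemma cd_inner_eq_lookup:
  "cd_inner n x y = Poly_Mapping.lookup (cd_mult n x (cd_conj n y)) 0"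
  by (simp add: cd_inner_def cd_Re_def lookup_cd lookup_cd_conj_0)

lemma cd_inner_bilinear [simp]:
  "cd_inner n 0 y = 0" "cd_inner n x 0 = 0"
  "cd_inner n (x + x') y = cd_inner n x y + cd_inner n x' y"
  "cd_inner n (x - x') y = cd_inner n x y - cd_inner n x' y"
  "cd_inner n (- x) y = - cd_inner n x y"
  "cd_inner n (r *\<^sub>R x) y = r * cd_inner n x y"
  "cd_inner n x (y + y') = cd_inner n x y + cd_inner n x y'"
  "cd_inner n x (y - y') = cd_inner n x y - cd_inner n x y'"
  "cd_inner n x (- y) = - cd_inner n x y"
  "cd_inner n x (r *\<^sub>R y) = r * cd_inner n x y"
  by (simp_all add: cd_inner_eq_lookup lookup_cd)

lemma cd_inner_eq_sum:
  assumes "x \<in> cd_carrier n" "y \<in> cd_carrier n"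
  shows "cd_inner n x y = (\<Sum>k<2 ^ n. Poly_Mapping.lookup x k * Poly_Mapping.lookup y k)"
  using assms by (simp add: cd_inner_eq_lookup cd_mult_conj_polarized(1))

lemma cd_inner_commute:
  assumes "x \<in> cd_carrier n" "y \<in> cd_carrier n"
  shows "cd_inner n x y = cd_inner n y x"
  using assms by (simp add: cd_inner_eq_sum mult.commute)

lemma cd_inner_pair:
  assumes "a \<in> cd_carrier n" "b \<in> cd_carrier n" "c \<in> cd_carrier n" "d \<in> cd_carrier n"
  shows "cd_inner (Suc n) (cd_pair n a b) (cd_pair n c d) = cd_inner n a c + cd_inner n b d"
  using assms by (simp add: cd_inner_eq_sum cd_pair_in_carrier sum_cd_pair del: power_Suc)

lemma cd_inner_self_nonneg: "x \<in> cd_carrier n \<Longrightarrow> 0 \<le> cd_inner n x x"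
  by (simp add: cd_inner_eq_sum sum_nonneg)

lemma cd_inner_self_eq_0: "x \<in> cd_carrier n \<Longrightarrow> cd_inner n x x = 0 \<longleftrightarrow> x = 0"
  by (auto intro!: poly_mapping_eqI simp: cd_inner_eq_sum sum_nonneg_eq_0_iff cd_carrier_iff)
    (metis lessThan_iff not_le)

lemma cd_norm_power2: "x \<in> cd_carrier n \<Longrightarrow> (cd_norm n x)\<^sup>2 = cd_inner n x x"
  using cd_inner_self_nonneg by (simp add: cd_norm_def flip: cd_inner_eq_lookup)

lemma cd_inner_conj:
  assumes "x \<in> cd_carrier n" "y \<in> cd_carrier n"
  shows "cd_inner n (cd_conj n x) (cd_conj n y) = cd_inner n x y"
  using assms cd_mult_conj_polarized(2)[OF assms] by (simp add: cd_inner_eq_lookup cd_inner_eq_sum)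
    (simp add: cd_inner_eq_sum flip: cd_inner_eq_lookup)

text \<open>This adjunction is the main replacement for associativity. The left and right versions
  go through one induction because the product of pairs multiplies components on both sides.\<close>

lemma cd_inner_mult:
  assumes "x \<in> cd_carrier n" "y \<in> cd_carrier n" "z \<in> cd_carrier n"
  shows "cd_inner n (cd_mult n x y) z = cd_inner n x (cd_mult n z (cd_conj n y))"
    and "cd_inner n (cd_mult n x y) z = cd_inner n y (cd_mult n (cd_conj n x) z)"
proof -
  have "cd_inner n (cd_mult n x y) z = cd_inner n x (cd_mult n z (cd_conj n y)) \<and>
    cd_inner n (cd_mult n x y) z = cd_inner n y (cd_mult n (cd_conj n x) z)"
    using assms
  proof (induction n arbitrary: x y z)
    case 0
    then show ?case by (simp add: cd_inner_eq_lookup)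
  next
    case (Suc n)
    obtain a b where x: "x = cd_pair n a b" and [simp]: "a \<in> cd_carrier n" "b \<in> cd_carrier n"
      using Suc.prems(1) by (rule cd_carrier_SucE)
    obtain c d where y: "y = cd_pair n c d" and [simp]: "c \<in> cd_carrier n" "d \<in> cd_carrier n"
      using Suc.prems(2) by (rule cd_carrier_SucE)
    obtain e f where z: "z = cd_pair n e f" and [simp]: "e \<in> cd_carrier n" "f \<in> cd_carrier n"
      using Suc.prems(3) by (rule cd_carrier_SucE)
    have 1: "cd_inner n (cd_mult n x y) z = cd_inner n x (cd_mult n z (cd_conj n y))"
      and 2: "cd_inner n (cd_mult n x y) z = cd_inner n y (cd_mult n (cd_conj n x) z)"
      if "x \<in> cd_carrier n" "y \<in> cd_carrier n" "z \<in> cd_carrier n" for x y z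
      using Suc.IH that by blast+
    \<comment> \<open>In the product formula c and d also occur conjugated; moving them out takes
      one adjunction followed by the invariance of the inner product under conjugation. The same
      holds for fact 4.\<close>
    have 3: "cd_inner n (cd_mult n b (cd_conj n c)) f = cd_inner n c (cd_mult n (cd_conj n f) b)"
      using 2[of b "cd_conj n c" f] cd_inner_conj[of "cd_conj n c" n "cd_mult n (cd_conj n b) f"]
      by (simp add: cd_conj_mult)
    have 4: "cd_inner n (cd_mult n (cd_conj n d) b) e = cd_inner n d (cd_mult n b (cd_conj n e))"
      using 1[of "cd_conj n d" b e] cd_inner_conj[of "cd_conj n d" n "cd_mult n e (cd_conj n b)"]
      by (simp add: cd_conj_mult)
    show ?case
      unfolding x y z
      using 1[of a c e] 2[of a c e] 1[of d a f] 2[of d a f] 1[of b "cd_conj n c" f] 3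
        2[of "cd_conj n d" b e] 4
      by (simp add: cd_mult_pair cd_conj_pair cd_inner_pair)
  qed
  then show "cd_inner n (cd_mult n x y) z = cd_inner n x (cd_mult n z (cd_conj n y))"
    and "cd_inner n (cd_mult n x y) z = cd_inner n y (cd_mult n (cd_conj n x) z)"
    by auto
qed

lemma cd_i_Suc: "cd_i (Suc n) = cd_pair n 0 cd_one"
  by (simp add: cd_i_def)

lemma cd_i_carrier [simp, intro]: "n \<ge> 1 \<Longrightarrow> cd_i n \<in> cd_carrier n"
  by (cases n) (auto simp: cd_i_Suc cd_pair_in_carrier)

lemma cd_mult_i_pair:
  assumes "a \<in> cd_carrier n" "b \<in> cd_carrier n"
  shows "cd_mult (Suc n) (cd_i (Suc n)) (cd_pair n a b) = cd_pair n (- cd_conj n b) (cd_conj n a)"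
    and "cd_mult (Suc n) (cd_pair n a b) (cd_i (Suc n)) = cd_pair n (- b) a"
  using assms by (simp_all add: cd_i_Suc cd_mult_pair)

lemma cd_conj_i: "n \<ge> 1 \<Longrightarrow> cd_conj n (cd_i n) = - cd_i n"
  by (cases n) (auto simp: cd_i_Suc cd_conj_pair simp flip: cd_pair_linear)

lemma cd_inner_one_one: "cd_inner n cd_one cd_one = 1"
  by (simp add: cd_inner_eq_lookup) (simp add: cd_one_def lookup_one)

lemma cd_inner_pair_C:
  assumes "a \<in> cd_carrier n" "b \<in> cd_carrier n"
  shows "cd_inner (Suc n) (cd_pair n a b) cd_one = cd_inner n a cd_one"
    and "cd_inner (Suc n) (cd_pair n a b) (cd_i (Suc n)) = cd_inner n b cd_one"
  using assms cd_inner_pair[of a n b cd_one 0]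
  by (simp_all add: cd_i_Suc cd_inner_pair flip: cd_one_Suc)

lemma cd_inner_i:
  assumes "n \<ge> 1"
  shows "cd_inner n (cd_i n) (cd_i n) = 1" "cd_inner n (cd_i n) cd_one = 0"
    "cd_inner n cd_one (cd_i n) = 0"
proof -
  obtain m where n: "n = Suc m" using assms by (cases n) auto
  show 0: "cd_inner n (cd_i n) (cd_i n) = 1"
    unfolding n by (simp add: cd_i_Suc cd_inner_pair cd_inner_one_one)
  show 1: "cd_inner n (cd_i n) cd_one = 0"
    unfolding n cd_i_Suc by (simp add: cd_inner_pair_C)
  show "cd_inner n cd_one (cd_i n) = 0"
    using 1 assms cd_inner_commute by simp
qed

lemma cd_mult_i_i:
  assumes "n \<ge> 1" "x \<in> cd_carrier n"
  shows "cd_mult n (cd_i n) (cd_mult n (cd_i n) x) = - x"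
proof -
  obtain m where n: "n = Suc m" using assms by (cases n) auto
  with assms obtain a b where "x = cd_pair m a b" "a \<in> cd_carrier m" "b \<in> cd_carrier m"
    by (metis cd_carrier_SucE)
  then show ?thesis
    by (simp add: n cd_mult_i_pair flip: cd_pair_linear(4))
qed

lemma cd_inner_mult_i:
  assumes "n \<ge> 1" "x \<in> cd_carrier n" "y \<in> cd_carrier n"
  shows "cd_inner n (cd_mult n (cd_i n) x) y = - cd_inner n x (cd_mult n (cd_i n) y)"
    and "cd_inner n (cd_mult n (cd_i n) x) (cd_mult n (cd_i n) y) = cd_inner n x y"
proof -
  have *: "cd_inner n (cd_mult n (cd_i n) x) y = - cd_inner n x (cd_mult n (cd_i n) y)"
    if "y \<in> cd_carrier n" for y
    using assms that cd_inner_mult(2)[of "cd_i n" n x y] by (simp add: cd_conj_i)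
  show "cd_inner n (cd_mult n (cd_i n) x) y = - cd_inner n x (cd_mult n (cd_i n) y)"
    using * assms by blast
  show "cd_inner n (cd_mult n (cd_i n) x) (cd_mult n (cd_i n) y) = cd_inner n x y"
    using *[of "cd_mult n (cd_i n) y"] assms by (simp add: cd_mult_i_i)
qed

section \<open>The Hermitian product and the complement of C_n\<close>

lemma mem_cd_C: "x \<in> cd_C n \<longleftrightarrow> (\<exists>r s. x = r *\<^sub>R cd_one + s *\<^sub>R cd_i n)"
  by (auto simp: cd_C_def span_insert algebra_simps)

lemma cd_orth_to_C:
  "cd_orth_to n x (cd_C n) \<longleftrightarrow> cd_inner n x cd_one = 0 \<and> cd_inner n x (cd_i n) = 0"
proof
  assume "cd_orth_to n x (cd_C n)"
  then show "cd_inner n x cd_one = 0 \<and> cd_inner n x (cd_i n) = 0"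
    by (auto simp: cd_orth_to_def cd_C_def span_base)
qed (auto simp: cd_orth_to_def mem_cd_C)

lemma cd_proj_C_eq:
  assumes "n \<ge> 1"
  shows "cd_proj_C n x = cd_inner n x cd_one *\<^sub>R cd_one + cd_inner n x (cd_i n) *\<^sub>R cd_i n"
  unfolding cd_proj_C_def cd_orth_to_C mem_cd_C
  by (rule the_equality) (use assms in \<open>auto simp: cd_inner_i cd_inner_one_one\<close>)

text \<open>By adjunction the coordinates of xy* along 1 and i_n are <x,y> and <x, i_n y>. Later
  arguments therefore treat Hermitian orthogonality as two real conditions.\<close>

lemma cd_herm_eq_0_iff:
  assumes "n \<ge> 1" "x \<in> cd_carrier n" "y \<in> cd_carrier n"
  shows "cd_herm n x y = 0 \<longleftrightarrow>
    cd_inner n x y = 0 \<and> cd_inner n x (cd_mult n (cd_i n) y) = 0"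
proof -
  have "cd_inner n (r *\<^sub>R cd_one + s *\<^sub>R cd_i n) cd_one = r"
    "cd_inner n (r *\<^sub>R cd_one + s *\<^sub>R cd_i n) (cd_i n) = s" for r s
    using assms by (simp_all add: cd_inner_i cd_inner_one_one)
  then have "r *\<^sub>R cd_one + s *\<^sub>R cd_i n = 0 \<longleftrightarrow> r = 0 \<and> s = 0" for r s
    by (metis add.right_neutral cd_inner_bilinear(1) scaleR_zero_left)
  then show ?thesis
    using assms cd_inner_mult(1)[of x n "cd_conj n y"] by (simp add: cd_herm_def cd_proj_C_eq)
qed

lemma cd_C_perp_iff:
  "x \<in> cd_C_perp n \<longleftrightarrow> x \<in> cd_carrier n \<and> cd_inner n x cd_one = 0 \<and> cd_inner n x (cd_i n) = 0"
  by (auto simp: cd_C_perp_def cd_orth_to_C)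

lemma cd_C_perp_closed [simp, intro]:
  "0 \<in> cd_C_perp n"
  "x \<in> cd_C_perp n \<Longrightarrow> y \<in> cd_C_perp n \<Longrightarrow> x + y \<in> cd_C_perp n"
  "x \<in> cd_C_perp n \<Longrightarrow> y \<in> cd_C_perp n \<Longrightarrow> x - y \<in> cd_C_perp n"
  "x \<in> cd_C_perp n \<Longrightarrow> - x \<in> cd_C_perp n"
  "x \<in> cd_C_perp n \<Longrightarrow> r *\<^sub>R x \<in> cd_C_perp n"
  by (auto simp: cd_C_perp_iff)

lemma cd_C_perp_carrier [simp, dest]: "x \<in> cd_C_perp n \<Longrightarrow> x \<in> cd_carrier n"
  by (simp add: cd_C_perp_iff)

lemma cd_mult_i_one: "n \<ge> 1 \<Longrightarrow> cd_mult n (cd_i n) (cd_i n) = - cd_one"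
  using cd_mult_i_i[of n cd_one] by simp

lemma cd_mult_i_C_perp [simp, intro]:
  assumes "n \<ge> 1" "x \<in> cd_C_perp n"
  shows "cd_mult n (cd_i n) x \<in> cd_C_perp n"
  using assms cd_inner_mult_i(1)[of n x cd_one] cd_inner_mult_i(1)[of n x "cd_i n"]
  by (simp add: cd_C_perp_iff cd_mult_i_one)

text \<open>The polarized norm identity with second argument 1.\<close>

lemma cd_conj_add_self:
  assumes "x \<in> cd_carrier n"
  shows "cd_conj n x = - x + (2 * cd_inner n x cd_one) *\<^sub>R cd_one"
  using cd_mult_conj_polarized(3)[OF assms cd_one_carrier] assms
  by (simp add: cd_inner_eq_sum algebra_simps)

lemma cd_conj_C_perp: "x \<in> cd_C_perp n \<Longrightarrow> cd_conj n x = - x"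
  by (simp add: cd_conj_add_self) (simp add: cd_C_perp_iff)

lemma cd_mult_imag_commute:
  assumes "x \<in> cd_carrier n" "y \<in> cd_carrier n" "cd_conj n x = - x" "cd_conj n y = - y"
  shows "cd_mult n y x = - cd_mult n x y - (2 * cd_inner n x y) *\<^sub>R cd_one"
proof -
  have "- cd_mult n x y - cd_mult n y x = (2 * cd_inner n x y) *\<^sub>R cd_one"
    using cd_mult_conj_polarized(3)[OF assms(1,2)] assms by (simp add: cd_inner_eq_sum)
  moreover have "cd_mult n y x = - cd_mult n x y - (- cd_mult n x y - cd_mult n y x)"
    by simp
  ultimately show ?thesis by simp
qed

text \<open>The coordinates of a pair along 1 and i_{n+1} are the real parts of its two components,
  so both components are purely imaginary. Conjugation in the product formula then becomes a
  sign.\<close>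

lemma cd_C_perp_SucE:
  assumes "x \<in> cd_C_perp (Suc n)"
  obtains a b where "x = cd_pair n a b" "a \<in> cd_carrier n" "b \<in> cd_carrier n"
    "cd_conj n a = - a" "cd_conj n b = - b"
proof -
  from assms obtain a b where x: "x = cd_pair n a b" "a \<in> cd_carrier n" "b \<in> cd_carrier n"
    by (metis cd_carrier_SucE cd_C_perp_carrier)
  with assms have "cd_inner n a cd_one = 0" "cd_inner n b cd_one = 0"
    by (simp_all add: cd_C_perp_iff cd_inner_pair_C)
  then show thesis using x that[of a b] by (simp add: cd_conj_add_self)
qed

lemma cd_mult_i_right:
  assumes "n \<ge> 1" "x \<in> cd_C_perp n"
  shows "cd_mult n x (cd_i n) = - cd_mult n (cd_i n) x"
proof -
  obtain m where n: "n = Suc m" using assms by (cases n) auto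
  from assms(2)[unfolded n] obtain a b where "x = cd_pair m a b" "a \<in> cd_carrier m"
    "b \<in> cd_carrier m" "cd_conj m a = - a" "cd_conj m b = - b"
    by (rule cd_C_perp_SucE)
  then show ?thesis
    by (simp add: n cd_mult_i_pair flip: cd_pair_linear(4))
qed

text \<open>What remains of associativity for the factor i_n: it can be pulled out of the product at
  the price of a sign and of a correction in C_n. The correction disappears after projection to
  C_n^perp, which makes P conjugate linear.\<close>

lemma cd_mult_i_assoc:
  assumes "n \<ge> 1" "x \<in> cd_C_perp n" "y \<in> cd_C_perp n"
  shows "cd_mult n (cd_mult n (cd_i n) x) y = - cd_mult n (cd_i n) (cd_mult n x y)
     + (2 * cd_inner n x (cd_mult n (cd_i n) y)) *\<^sub>R cd_one - (2 * cd_inner n x y) *\<^sub>R cd_i n"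
proof -
  obtain m where n: "n = Suc m" using assms by (cases n) auto
  obtain a b where x: "x = cd_pair m a b" and [simp]: "a \<in> cd_carrier m" "b \<in> cd_carrier m"
    "cd_conj m a = - a" "cd_conj m b = - b"
    using assms(2) unfolding n by (rule cd_C_perp_SucE)
  obtain c d where y: "y = cd_pair m c d" and [simp]: "c \<in> cd_carrier m" "d \<in> cd_carrier m"
    "cd_conj m c = - c" "cd_conj m d = - d"
    using assms(3) unfolding n by (rule cd_C_perp_SucE)
  have C: "r *\<^sub>R cd_one - s *\<^sub>R cd_i n = cd_pair m (r *\<^sub>R cd_one) (- (s *\<^sub>R cd_one))" for r s
    using cd_pair_linear(2)[of m "r *\<^sub>R cd_one" 0 0 "- (s *\<^sub>R cd_one)"]
      cd_pair_linear(5)[of m "- s" 0 cd_one] by (simp add: cd_pair_one n cd_i_Suc)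
  have "cd_mult n (cd_mult n (cd_i n) x) y = - cd_mult n (cd_i n) (cd_mult n x y)
     + cd_pair m ((2 * cd_inner n x (cd_mult n (cd_i n) y)) *\<^sub>R cd_one)
         (- ((2 * cd_inner n x y) *\<^sub>R cd_one))"
  proof -
    \<comment> \<open>The two sides differ by the order of imaginary factors in A_m; each exchange
      costs a sign and a real multiple of 1, and these multiples add up to the correction.\<close>
    have "cd_mult m b c - cd_mult m d a = (cd_mult m a d - cd_mult m c b)
        + (2 * (cd_inner m a d - cd_inner m b c)) *\<^sub>R cd_one"
      by (simp add: cd_mult_imag_commute[of b m c] cd_mult_imag_commute[of a m d] algebra_simps)
    moreover have "cd_mult m d b + cd_mult m a c = (- cd_mult m c a - cd_mult m b d)
        + (- ((2 * (cd_inner m a c + cd_inner m b d)) *\<^sub>R cd_one))"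
      by (simp add: cd_mult_imag_commute[of b m d] cd_mult_imag_commute[of a m c] algebra_simps)
    ultimately have "cd_pair m (cd_mult m b c - cd_mult m d a) (cd_mult m d b + cd_mult m a c) =
        cd_pair m (cd_mult m a d - cd_mult m c b) (- cd_mult m c a - cd_mult m b d) +
        cd_pair m ((2 * (cd_inner m a d - cd_inner m b c)) *\<^sub>R cd_one)
          (- ((2 * (cd_inner m a c + cd_inner m b d)) *\<^sub>R cd_one))"
      by (simp only: cd_pair_linear(2))
    then show ?thesis
      unfolding n x y
      by (simp add: cd_mult_i_pair cd_mult_pair cd_inner_pair cd_conj_mult cd_pair_linear(4)[symmetric])
  qed
  then show ?thesis
    by (simp flip: C)
qed

section \<open>Multiplication of brace elements\<close>

text \<open>The simplifier turns \<open>(2 * r) *\<^sub>R x\<close> into the convolution product \<open>2 * (r *\<^sub>R x)\<close>.\<close>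

lemma lookup_2_times: "Poly_Mapping.lookup (2 * x) k = 2 * Poly_Mapping.lookup x k" for x :: cd
  by (simp only: mult_2 lookup_add)

lemmas lookup_linear = lookup_add lookup_minus lookup_uminus lookup_scaleR lookup_2_times

lemma cd_mult_C_C_perp:
  assumes "n \<ge> 1" "x \<in> cd_C_perp n"
  shows "cd_mult n (r *\<^sub>R cd_one + s *\<^sub>R cd_i n) x = r *\<^sub>R x + s *\<^sub>R cd_mult n (cd_i n) x"
    and "cd_mult n x (r *\<^sub>R cd_one + s *\<^sub>R cd_i n) = r *\<^sub>R x - s *\<^sub>R cd_mult n (cd_i n) x"
  using assms by (simp_all add: cd_mult_i_right)

text \<open>For x and y in C_n^perp this is the component of xy in C_n^perp.\<close>

definition cd_perp_mult :: "nat \<Rightarrow> cd \<Rightarrow> cd \<Rightarrow> cd" where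
  "cd_perp_mult n x y = cd_mult n x y + cd_inner n x y *\<^sub>R cd_one
     + cd_inner n x (cd_mult n (cd_i n) y) *\<^sub>R cd_i n"

lemma cd_mult_eq_perp_mult:
  "cd_mult n x y = cd_perp_mult n x y - cd_inner n x y *\<^sub>R cd_one
     - cd_inner n x (cd_mult n (cd_i n) y) *\<^sub>R cd_i n"
  by (simp add: cd_perp_mult_def)

lemma cd_perp_mult_bilinear [simp]:
  "cd_perp_mult n 0 y = 0" "cd_perp_mult n x 0 = 0"
  "cd_perp_mult n (x + x') y = cd_perp_mult n x y + cd_perp_mult n x' y"
  "cd_perp_mult n (x - x') y = cd_perp_mult n x y - cd_perp_mult n x' y"
  "cd_perp_mult n (- x) y = - cd_perp_mult n x y"
  "cd_perp_mult n (r *\<^sub>R x) y = r *\<^sub>R cd_perp_mult n x y"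
  "cd_perp_mult n x (y + y') = cd_perp_mult n x y + cd_perp_mult n x y'"
  "cd_perp_mult n x (y - y') = cd_perp_mult n x y - cd_perp_mult n x y'"
  "cd_perp_mult n x (- y) = - cd_perp_mult n x y"
  "cd_perp_mult n x (r *\<^sub>R y) = r *\<^sub>R cd_perp_mult n x y"
  by (simp_all add: cd_perp_mult_def algebra_simps)

lemma cd_brace_linear [simp]:
  "cd_brace n 0 0 = 0"
  "cd_brace n (x + x') (y + y') = cd_brace n x y + cd_brace n x' y'"
  "cd_brace n (x - x') (y - y') = cd_brace n x y - cd_brace n x' y'"
  "cd_brace n (- x) (- y) = - cd_brace n x y"
  "cd_brace n (r *\<^sub>R x) (r *\<^sub>R y) = r *\<^sub>R cd_brace n x y"
  by (auto intro!: poly_mapping_eqI simp: cd_brace_def lookup_cd field_simps)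

lemma cd_brace_carrier [simp, intro]: "cd_brace n x y \<in> cd_carrier (Suc n)"
  by (auto simp: cd_brace_def cd_pair_in_carrier)

context
  fixes n :: nat
  assumes n: "n \<ge> 1"
begin

lemma cd_inner_i_commute:
  assumes "x \<in> cd_carrier n" "y \<in> cd_carrier n"
  shows "cd_inner n y (cd_mult n (cd_i n) x) = - cd_inner n x (cd_mult n (cd_i n) y)"
  using assms n by (metis cd_inner_mult_i(1) cd_inner_commute cd_mult_carrier)

text \<open>Since y* = -y, adjunction gives xy the coordinates -<x,y> and -<x, i_n y> along 1 and
  i_n. The terms added in \<open>cd_perp_mult\<close> remove exactly these.\<close>

lemma cd_perp_mult_C_perp [simp, intro]:
  assumes "x \<in> cd_C_perp n" "y \<in> cd_C_perp n"
  shows "cd_perp_mult n x y \<in> cd_C_perp n"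
proof -
  have "cd_inner n (cd_mult n x y) cd_one = - cd_inner n x y"
    "cd_inner n (cd_mult n x y) (cd_i n) = - cd_inner n x (cd_mult n (cd_i n) y)"
    using assms n cd_inner_mult(1)[of x n y] by (simp_all add: cd_conj_C_perp)
  then show ?thesis
    using assms n by (simp add: cd_C_perp_iff cd_perp_mult_def cd_inner_i cd_inner_one_one)
qed

lemma cd_perp_mult_commute:
  assumes "x \<in> cd_C_perp n" "y \<in> cd_C_perp n"
  shows "cd_perp_mult n y x = - cd_perp_mult n x y"
proof -
  have "cd_mult n y x = - cd_mult n x y - (2 * cd_inner n x y) *\<^sub>R cd_one"
    using assms by (intro cd_mult_imag_commute) (simp_all add: cd_conj_C_perp)
  moreover have "cd_inner n y x = cd_inner n x y"
    "cd_inner n y (cd_mult n (cd_i n) x) = - cd_inner n x (cd_mult n (cd_i n) y)"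
    using assms cd_inner_commute[of y n x] cd_inner_i_commute[of x y] by auto
  ultimately show ?thesis
    unfolding cd_perp_mult_def by (simp only:) (rule poly_mapping_eqI, simp add: lookup_linear)
qed

lemma cd_perp_mult_self: "x \<in> cd_C_perp n \<Longrightarrow> cd_perp_mult n x x = 0"
  using cd_perp_mult_commute[of x x] n by simp

text \<open>The first argument is \<open>cd_mult_i_assoc\<close>, whose correction is absorbed by
  the projection; the second follows by antisymmetry.\<close>

lemma cd_perp_mult_i:
  assumes "x \<in> cd_C_perp n" "y \<in> cd_C_perp n"
  shows "cd_perp_mult n (cd_mult n (cd_i n) x) y = - cd_mult n (cd_i n) (cd_perp_mult n x y)"
    and "cd_perp_mult n x (cd_mult n (cd_i n) y) = - cd_mult n (cd_i n) (cd_perp_mult n x y)"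
proof -
  have *: "cd_perp_mult n (cd_mult n (cd_i n) x) y = - cd_mult n (cd_i n) (cd_perp_mult n x y)"
    if "x \<in> cd_C_perp n" "y \<in> cd_C_perp n" for x y
    using that n
    by (simp add: cd_perp_mult_def cd_mult_i_assoc cd_inner_mult_i cd_mult_i_one cd_mult_i_i)
      (auto intro!: poly_mapping_eqI simp: lookup_linear)
  show "cd_perp_mult n (cd_mult n (cd_i n) x) y = - cd_mult n (cd_i n) (cd_perp_mult n x y)"
    using * assms by blast
  show "cd_perp_mult n x (cd_mult n (cd_i n) y) = - cd_mult n (cd_i n) (cd_perp_mult n x y)"
    using *[OF assms(2,1)] cd_perp_mult_commute[OF assms(2,1)]
      cd_perp_mult_commute[of "cd_mult n (cd_i n) y" x] assms n by simp
qed

text \<open>Inherited from x* = -x, because the C_n-component of a product is invisible when paired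
  with an element of C_n^perp.\<close>

lemma cd_inner_perp_mult:
  assumes "x \<in> cd_C_perp n" "y \<in> cd_C_perp n" "z \<in> cd_C_perp n"
  shows "cd_inner n (cd_perp_mult n x y) z = - cd_inner n y (cd_perp_mult n x z)"
proof -
  have "cd_inner n (cd_mult n x y) z = - cd_inner n y (cd_mult n x z)"
    using assms cd_inner_mult(2)[of x n y z] by (simp add: cd_conj_C_perp)
  moreover have "cd_inner n cd_one z = 0" "cd_inner n (cd_i n) z = 0"
    using assms n cd_inner_commute[of _ n z] by (auto simp: cd_C_perp_iff)
  ultimately show ?thesis
    using assms n by (simp add: cd_perp_mult_def) (simp add: cd_C_perp_iff)
qed

text \<open>Moving x across by skew-adjointness leaves P(x,x) or P(x, i_n x), and both
  vanish.\<close>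

lemma cd_inner_perp_mult_self:
  assumes "x \<in> cd_C_perp n" "y \<in> cd_C_perp n"
  shows "cd_inner n (cd_perp_mult n x y) x = 0"
    and "cd_inner n (cd_perp_mult n x y) (cd_mult n (cd_i n) x) = 0"
  using assms n by (simp_all add: cd_inner_perp_mult cd_perp_mult_i cd_perp_mult_self)

text \<open>A polarized parallelogram identity, with i_n acting as an isometry; it accounts for the
  factor 1 / sqrt 2 in the brace.\<close>

lemma cd_inner_brace:
  assumes "x \<in> cd_carrier n" "y \<in> cd_carrier n" "x' \<in> cd_carrier n" "y' \<in> cd_carrier n"
  shows "cd_inner (Suc n) (cd_brace n x y) (cd_brace n x' y') = cd_inner n x x' + cd_inner n y y'"
  using assms n
  by (simp add: cd_brace_def cd_inner_pair cd_inner_mult_i(2) field_simps)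

lemma cd_inner_brace_pair_C:
  assumes "x \<in> cd_C_perp n" "y \<in> cd_C_perp n" "\<alpha> \<in> cd_C n" "\<beta> \<in> cd_C n"
  shows "cd_inner (Suc n) (cd_brace n x y) (cd_pair n \<alpha> \<beta>) = 0"
proof -
  obtain r s t u where "\<alpha> = r *\<^sub>R cd_one + s *\<^sub>R cd_i n" "\<beta> = t *\<^sub>R cd_one + u *\<^sub>R cd_i n"
    using assms by (auto simp: mem_cd_C)
  moreover have "cd_inner n v cd_one = 0 \<and> cd_inner n v (cd_i n) = 0" if "v \<in> cd_C_perp n" for v
    using that by (simp add: cd_C_perp_iff)
  ultimately show ?thesis
    using assms n by (simp add: cd_brace_def cd_inner_pair)
qed

text \<open>Braces are orthogonal to pairs from C_n, so the squared norm of the sum is the sum of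
  the squares of all coordinates.\<close>

lemma cd_brace_plus_pair_eq_0:
  assumes "x \<in> cd_C_perp n" "y \<in> cd_C_perp n"
    and 0: "cd_brace n x y + cd_pair n (r *\<^sub>R cd_one + s *\<^sub>R cd_i n) (t *\<^sub>R cd_one + u *\<^sub>R cd_i n) = 0"
  shows "x = 0" "y = 0" "r = 0" "s = 0" "t = 0" "u = 0"
proof -
  let ?p = "cd_pair n (r *\<^sub>R cd_one + s *\<^sub>R cd_i n) (t *\<^sub>R cd_one + u *\<^sub>R cd_i n)"
  let ?z = "cd_brace n x y + ?p"
  have 1: "cd_inner (Suc n) (cd_brace n x y) ?p = 0"
    using assms by (intro cd_inner_brace_pair_C) (auto simp: mem_cd_C)
  then have 2: "cd_inner (Suc n) ?p (cd_brace n x y) = 0"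
    by (simp add: cd_inner_commute cd_pair_in_carrier)
  have 3: "cd_inner (Suc n) ?p ?p = r\<^sup>2 + s\<^sup>2 + t\<^sup>2 + u\<^sup>2"
    using n by (simp add: cd_inner_pair cd_inner_i cd_inner_one_one power2_eq_square)
  have "cd_inner n x x + cd_inner n y y + (r\<^sup>2 + s\<^sup>2 + t\<^sup>2 + u\<^sup>2) = cd_inner (Suc n) ?z ?z"
    using 1 2 3 assms(1,2) by (simp add: cd_inner_brace)
  also have "\<dots> = 0"
    using 0 by (simp only: cd_inner_bilinear(1))
  finally have *: "cd_inner n x x + cd_inner n y y + (r\<^sup>2 + s\<^sup>2 + t\<^sup>2 + u\<^sup>2) = 0" .
  have "0 \<le> cd_inner n x x" "0 \<le> cd_inner n y y" "0 \<le> r\<^sup>2" "0 \<le> s\<^sup>2" "0 \<le> t\<^sup>2" "0 \<le> u\<^sup>2"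
    using assms cd_inner_self_nonneg by auto
  with * have "cd_inner n x x = 0 \<and> cd_inner n y y = 0 \<and> r\<^sup>2 = 0 \<and> s\<^sup>2 = 0 \<and> t\<^sup>2 = 0 \<and> u\<^sup>2 = 0"
    by linarith
  then show "x = 0" "y = 0" "r = 0" "s = 0" "t = 0" "u = 0"
    using assms(1,2) by (auto simp: cd_inner_self_eq_0)
qed

lemma cd_brace_plus_pair_C:
  assumes "z \<in> cd_carrier (Suc n)"
  obtains x y r s t u where "x \<in> cd_C_perp n" "y \<in> cd_C_perp n"
    "z = cd_brace n x y + cd_pair n (r *\<^sub>R cd_one + s *\<^sub>R cd_i n) (t *\<^sub>R cd_one + u *\<^sub>R cd_i n)"
proof -
  have C: "\<exists>x' r s. x' \<in> cd_C_perp n \<and> x = x' + (r *\<^sub>R cd_one + s *\<^sub>R cd_i n)"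
    if x: "x \<in> cd_carrier n" for x
  proof -
    have "x - (cd_inner n x cd_one *\<^sub>R cd_one + cd_inner n x (cd_i n) *\<^sub>R cd_i n) \<in> cd_C_perp n"
      using x n by (simp add: cd_C_perp_iff cd_inner_i cd_inner_one_one)
    then show ?thesis by (metis diff_add_cancel)
  qed
  obtain a b where z: "z = cd_pair n a b" and "a \<in> cd_carrier n" "b \<in> cd_carrier n"
    using assms by (rule cd_carrier_SucE)
  with C obtain p r s q t u where p: "p \<in> cd_C_perp n" "a = p + (r *\<^sub>R cd_one + s *\<^sub>R cd_i n)"
    and q: "q \<in> cd_C_perp n" "b = q + (t *\<^sub>R cd_one + u *\<^sub>R cd_i n)"
    by metis
  \<comment> \<open>Solution of x + y = sqrt 2 p and i_n(-x + y) = sqrt 2 q, which together say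
    {x,y} = (p,q).\<close>
  let ?x = "(1 / sqrt 2) *\<^sub>R (p + cd_mult n (cd_i n) q)"
  let ?y = "(1 / sqrt 2) *\<^sub>R (p - cd_mult n (cd_i n) q)"
  have "?x + ?y = sqrt 2 *\<^sub>R p" "- ?x + ?y = - sqrt 2 *\<^sub>R cd_mult n (cd_i n) q"
    by (auto intro!: poly_mapping_eqI simp: lookup_linear field_simps)
  then have "cd_brace n ?x ?y = cd_pair n p q"
    using p q n unfolding cd_brace_def by (simp add: cd_mult_i_i cd_pair_linear(5))
  moreover have "?x \<in> cd_C_perp n" "?y \<in> cd_C_perp n"
    using p q n by auto
  ultimately show thesis
    using that[of ?x ?y r s t u] z p(2) q(2) by (simp add: cd_pair_linear(2) del: cd_brace_linear)
qed

text \<open>The first slot carries the conjugate complex structure, the second the original one.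
  Hence C_{n+1} preserves the set of braces, and subspaces stable under i_n may be used in either
  slot.\<close>

lemma cd_mult_i_brace:
  assumes "x \<in> cd_C_perp n" "y \<in> cd_C_perp n"
  shows "cd_mult (Suc n) (cd_i (Suc n)) (cd_brace n x y) =
    cd_brace n (- cd_mult n (cd_i n) x) (cd_mult n (cd_i n) y)"
  using assms n
  by (simp add: cd_brace_def cd_mult_i_pair cd_conj_C_perp cd_mult_i_i)

text \<open>Conjugate linearity in both arguments gives P(i_n u, i_n v) = -P(u,v). With
  antisymmetry, the mixed terms P(a,y) and P(b,x) cancel and P(a,x), P(b,y) double. The two factors
  1 / sqrt 2 absorb this 2, and restoring the one inside the resulting brace leaves sqrt 2.\<close>

lemma cd_mult_brace_brace:
  assumes "a \<in> cd_C_perp n" "b \<in> cd_C_perp n" "x \<in> cd_C_perp n" "y \<in> cd_C_perp n"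
  defines "s \<equiv> cd_inner n" and "w \<equiv> \<lambda>u v. cd_inner n u (cd_mult n (cd_i n) v)"
  shows "cd_mult (Suc n) (cd_brace n a b) (cd_brace n x y) =
    sqrt 2 *\<^sub>R cd_brace n (cd_perp_mult n a x) (cd_perp_mult n b y) +
    cd_pair n ((- (s a x + s b y)) *\<^sub>R cd_one + (- (w a y + w b x)) *\<^sub>R cd_i n)
      ((w a x - w b y) *\<^sub>R cd_one + (s b x - s a y) *\<^sub>R cd_i n)"
proof -
  note [simp] = n[unfolded One_nat_def] cd_mult_i_C_perp[OF n]
  note V = assms(1-4)
  let ?i = "cd_mult n (cd_i n)" and ?P = "cd_perp_mult n"
  note mult = cd_mult_eq_perp_mult[of n "a + b" "x + y"] cd_mult_eq_perp_mult[of n "x + y" "a + b"]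
    cd_mult_eq_perp_mult[of n "?i (- x + y)" "?i (- a + b)"]
    cd_mult_eq_perp_mult[of n "?i (- x + y)" "a + b"]
    cd_mult_eq_perp_mult[of n "?i (- a + b)" "x + y"]
  note P = cd_perp_mult_commute[OF V(1,3)] cd_perp_mult_commute[OF V(1,4)]
    cd_perp_mult_commute[OF V(2,3)] cd_perp_mult_commute[OF V(2,4)]
  note s = cd_inner_commute[of x n a] cd_inner_commute[of x n b]
    cd_inner_commute[of y n a] cd_inner_commute[of y n b]
  note w = cd_inner_i_commute[of a x] cd_inner_i_commute[of a y]
    cd_inner_i_commute[of b x] cd_inner_i_commute[of b y]
  have conj: "cd_conj n (u *\<^sub>R v) = - (u *\<^sub>R v)" if "v \<in> cd_C_perp n" for u v
    using that by (simp add: cd_conj_C_perp)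
  have 1: "cd_mult n (a + b) (x + y) + cd_mult n (?i (- x + y)) (?i (- a + b)) =
      2 *\<^sub>R (?P a x + ?P b y) + 2 *\<^sub>R ((- (s a x + s b y)) *\<^sub>R cd_one + (- (w a y + w b x)) *\<^sub>R cd_i n)"
    unfolding mult s_def w_def using V
    by (simp add: cd_perp_mult_i cd_mult_i_i cd_inner_mult_i P s w)
      (rule poly_mapping_eqI, simp add: lookup_linear algebra_simps)
  have 2: "cd_mult n (?i (- x + y)) (a + b) - cd_mult n (?i (- a + b)) (x + y) =
      2 *\<^sub>R ?i (- ?P a x + ?P b y) + 2 *\<^sub>R ((w a x - w b y) *\<^sub>R cd_one + (s b x - s a y) *\<^sub>R cd_i n)"
    unfolding mult s_def w_def using V
    by (simp add: cd_perp_mult_i cd_mult_i_i cd_inner_mult_i P s w)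
      (rule poly_mapping_eqI, simp add: lookup_linear algebra_simps)
  let ?S = "1 / sqrt 2"
  have half: "?S *\<^sub>R (?S *\<^sub>R v) = (1 / 2) *\<^sub>R v" for v :: cd
    by simp
  have "cd_mult (Suc n) (cd_brace n a b) (cd_brace n x y) =
      (1 / 2) *\<^sub>R cd_mult (Suc n) (cd_pair n (a + b) (?i (- a + b))) (cd_pair n (x + y) (?i (- x + y)))"
    unfolding cd_brace_def by simp
  also have "\<dots> = (1 / 2) *\<^sub>R cd_pair n
      (cd_mult n (a + b) (x + y) + cd_mult n (?i (- x + y)) (?i (- a + b)))
      (cd_mult n (?i (- x + y)) (a + b) - cd_mult n (?i (- a + b)) (x + y))"
  proof -
    have "cd_conj n (x + y) = - (x + y)" "cd_conj n (?i (- x + y)) = - ?i (- x + y)"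
      using V by (simp_all add: cd_conj_C_perp)
    moreover have "a + b \<in> cd_carrier n" "x + y \<in> cd_carrier n"
      "?i (- a + b) \<in> cd_carrier n" "?i (- x + y) \<in> cd_carrier n"
      using V by auto
    ultimately show ?thesis
      by (simp only: cd_mult_pair) (simp only: bilinear_lneg[OF bilinear_cd_mult]
          bilinear_rneg[OF bilinear_cd_mult] diff_minus_eq_add add_uminus_conv_diff)
  qed
  also have "\<dots> = sqrt 2 *\<^sub>R cd_brace n (?P a x) (?P b y) +
    cd_pair n ((- (s a x + s b y)) *\<^sub>R cd_one + (- (w a y + w b x)) *\<^sub>R cd_i n)
      ((w a x - w b y) *\<^sub>R cd_one + (s b x - s a y) *\<^sub>R cd_i n)"
    unfolding 1 2 cd_pair_linear(2,5) cd_brace_def by (simp add: scaleR_add_right)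
  finally show ?thesis .
qed

text \<open>For p in C_n^perp and alpha in C_n, p alpha = alpha* p, so both components of the
  product stay in C_n^perp. Writing them as x + y and i_n(-x + y) produces the two slots.\<close>

lemma cd_mult_brace_pair_C:
  assumes "a \<in> cd_C_perp n" "b \<in> cd_C_perp n"
  shows "cd_mult (Suc n) (cd_brace n a b)
      (cd_pair n (r *\<^sub>R cd_one + s *\<^sub>R cd_i n) (t *\<^sub>R cd_one + u *\<^sub>R cd_i n)) =
    cd_brace n (r *\<^sub>R a + t *\<^sub>R cd_mult n (cd_i n) a - u *\<^sub>R b - s *\<^sub>R cd_mult n (cd_i n) b)
      (u *\<^sub>R a - s *\<^sub>R cd_mult n (cd_i n) a + r *\<^sub>R b - t *\<^sub>R cd_mult n (cd_i n) b)"
    (is "_ = cd_brace n ?x ?y")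
proof -
  note [simp] = n[unfolded One_nat_def] cd_mult_i_C_perp[OF n]
  let ?i = "cd_mult n (cd_i n)" and ?S = "1 / sqrt 2"
  let ?p = "a + b" and ?q = "?i (- a + b)"
  let ?\<alpha> = "r *\<^sub>R cd_one + s *\<^sub>R cd_i n" and ?\<beta> = "t *\<^sub>R cd_one + u *\<^sub>R cd_i n"
  have V: "?p \<in> cd_C_perp n" "?q \<in> cd_C_perp n"
    using assms by auto
  have 1: "cd_mult n ?p ?\<alpha> - cd_mult n (cd_conj n ?\<beta>) ?q = ?x + ?y"
    using V assms cd_mult_C_C_perp(2)[of n ?p r s] cd_mult_C_C_perp(1)[of n ?q t "- u"]
    by (simp add: cd_mult_C_C_perp cd_conj_i cd_mult_i_i cd_mult_i_right)
      (rule poly_mapping_eqI, simp add: lookup_linear algebra_simps)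
  have 2: "cd_mult n ?\<beta> ?p + cd_mult n ?q (cd_conj n ?\<alpha>) = ?i (- ?x + ?y)"
    using V assms cd_mult_C_C_perp(1)[of n ?p t u] cd_mult_C_C_perp(2)[of n ?q r "- s"]
    by (simp add: cd_mult_C_C_perp cd_conj_i cd_mult_i_i cd_mult_i_right)
      (rule poly_mapping_eqI, simp add: lookup_linear algebra_simps)
  have "cd_mult (Suc n) (cd_pair n ?p ?q) (cd_pair n ?\<alpha> ?\<beta>) =
      cd_pair n (?x + ?y) (?i (- ?x + ?y))"
    using V by (subst cd_mult_pair; (simp only: 1 2)?) auto
  then show ?thesis
    unfolding cd_brace_def by (simp only: cd_mult_bilinear)
qed

end

section \<open>Orthogonal sums and dimensions\<close>

text \<open>An injective endomorphism of a finite-dimensional space is onto, stated for a finitely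
  spanned subspace. A vector outside the image could be added to the image of a basis, giving an
  independent set that is too large.\<close>

lemma subspace_subset_linear_image:
  fixes f :: "'a::real_vector \<Rightarrow> 'a"
  assumes f: "linear f" and S: "subspace S" "S \<subseteq> span F" "finite F"
    and inj: "inj_on f S" and into: "f ` S \<subseteq> S"
  shows "S \<subseteq> f ` S"
proof
  fix v assume v: "v \<in> S"
  obtain B where B: "B \<subseteq> S" "independent B" "S \<subseteq> span B" "card B = dim S"
    by (rule basis_exists)
  have span_B: "span B = S"
    using B(1,3) span_minimal[OF B(1) S(1)] by (intro subset_antisym)
  have fin: "finite B"
    using independent_span_bound[OF S(3) B(2) subset_trans[OF B(1) S(2)]] ..
  have indep: "independent (f ` B)"
    using linear_independent_injective_image[OF f B(2)] inj span_B by simp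
  have card: "card (f ` B) = card B"
    by (rule card_image[OF inj_on_subset[OF inj B(1)]])
  have "v \<in> span (f ` B)"
  proof (rule ccontr)
    assume "v \<notin> span (f ` B)"
    then have "independent (insert v (f ` B))" "v \<notin> f ` B"
      using indep by (auto simp: independent_insertI span_base)
    moreover have "insert v (f ` B) \<subseteq> span B"
      using v into B(1) span_B by blast
    ultimately have "card (insert v (f ` B)) \<le> card B" "v \<notin> f ` B"
      using independent_span_bound[OF fin] by auto
    then show False
      using fin card by simp
  qed
  then show "v \<in> f ` S"
    using linear_span_image[OF f, of B] span_B by simp
qed

lemma dim_linear_image_inj:
  fixes f :: "'a::real_vector \<Rightarrow> 'b::real_vector"
  assumes f: "linear f" and S: "subspace S" and inj: "inj_on f S"
  shows "dim (f ` S) = dim S"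
proof -
  obtain B where B: "B \<subseteq> S" "independent B" "S \<subseteq> span B" "card B = dim S"
    by (rule basis_exists)
  have span_B: "span B = S"
    using B(3) span_minimal[OF B(1) S] by (intro subset_antisym)
  have "independent (f ` B)"
    using linear_independent_injective_image[OF f B(2)] inj span_B by simp
  moreover have "card (f ` B) = dim S"
    using card_image[OF inj_on_subset[OF inj B(1)]] B(4) by simp
  moreover have "f ` S \<subseteq> span (f ` B)"
    using linear_span_image[OF f, of B] span_B by simp
  ultimately show ?thesis
    using B(1) by (intro dim_unique) auto
qed

text \<open>The finite spanning sets guarantee finite bases; \<open>dim\<close> counts a basis by
  \<open>card\<close>, which is 0 on infinite sets.\<close>

lemma dim_direct_sum:
  fixes S T :: "'a::real_vector set"
  assumes S: "subspace S" "S \<subseteq> span F" "finite F" and T: "subspace T" "T \<subseteq> span G" "finite G"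
    and ST: "S \<inter> T = {0}"
  shows "dim {x + y |x y. x \<in> S \<and> y \<in> T} = dim S + dim T"
proof -
  obtain B where B: "B \<subseteq> S" "independent B" "S \<subseteq> span B" "card B = dim S"
    by (rule basis_exists)
  obtain C where C: "C \<subseteq> T" "independent C" "T \<subseteq> span C" "card C = dim T"
    by (rule basis_exists)
  have fin: "finite B" "finite C"
    using independent_span_bound[OF S(3) B(2) subset_trans[OF B(1) S(2)]]
      independent_span_bound[OF T(3) C(2) subset_trans[OF C(1) T(2)]] by simp_all
  have disj: "B \<inter> C = {}"
  proof -
    have "0 \<notin> B"
      using B(2) dependent_zero[of B] by auto
    moreover have "B \<inter> C \<subseteq> S \<inter> T"
      using B(1) C(1) by blast
    ultimately show ?thesis
      unfolding ST by blast
  qed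
  have "independent (B \<union> C)"
  proof (rule independent_if_scalars_zero)
    fix f x assume sum: "(\<Sum>x\<in>B \<union> C. f x *\<^sub>R x) = 0" and x: "x \<in> B \<union> C"
    let ?s = "\<Sum>x\<in>B. f x *\<^sub>R x" and ?t = "\<Sum>x\<in>C. f x *\<^sub>R x"
    have 0: "?s + ?t = 0"
      using sum fin disj by (simp add: sum.union_disjoint)
    have s: "?s \<in> S" and t: "?t \<in> T"
      using B(1) C(1) S(1) T(1) by (auto intro!: subspace_sum subspace_scale)
    have "?s = - ?t"
      using 0 by (simp add: eq_neg_iff_add_eq_0)
    then have "?s \<in> S \<inter> T"
      using s t T(1) by (simp add: subspace_neg)
    then have "?s = 0" "?t = 0"
      using ST 0 by auto
    then show "f x = 0"
      using x independentD[OF B(2) fin(1) order_refl, of f x]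
        independentD[OF C(2) fin(2) order_refl, of f x] by auto
  qed (use fin in simp)
  moreover have "B \<union> C \<subseteq> {x + y |x y. x \<in> S \<and> y \<in> T}"
  proof
    fix v assume "v \<in> B \<union> C"
    then have "v \<in> S \<and> 0 \<in> T \<and> v = v + 0 \<or> 0 \<in> S \<and> v \<in> T \<and> v = 0 + v"
      using B(1) C(1) subspace_0[OF S(1)] subspace_0[OF T(1)] by auto
    then show "v \<in> {x + y |x y. x \<in> S \<and> y \<in> T}"
      by blast
  qed
  moreover have "{x + y |x y. x \<in> S \<and> y \<in> T} \<subseteq> span (B \<union> C)"
  proof clarify
    fix x y assume "x \<in> S" "y \<in> T"
    then have "x \<in> span (B \<union> C)" "y \<in> span (B \<union> C)"
      using B(3) C(3) span_mono[of B "B \<union> C"] span_mono[of C "B \<union> C"] by auto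
    then show "x + y \<in> span (B \<union> C)"
      by (rule span_add)
  qed
  moreover have "card (B \<union> C) = dim S + dim T"
    using B(4) C(4) fin disj by (simp add: card_Un_disjoint)
  ultimately show ?thesis
    by (intro dim_unique) auto
qed

lemma cd_carrier_finite_dim:
  obtains F where "finite F" "cd_carrier n \<subseteq> span F"
proof
  let ?F = "(\<lambda>k. Poly_Mapping.single k (1::real)) ` {..<2 ^ n :: nat}"
  show "finite ?F" by simp
  show "cd_carrier n \<subseteq> span ?F"
  proof
    fix x assume x: "x \<in> cd_carrier n"
    have "x = (\<Sum>k<2 ^ n. Poly_Mapping.single (0 + k) (Poly_Mapping.lookup x k))"
      by (rule poly_mapping_eqI, subst lookup_cd_block) (use x in \<open>auto simp: cd_carrier_iff\<close>)
    also have "\<dots> = (\<Sum>k<2 ^ n. Poly_Mapping.lookup x k *\<^sub>R Poly_Mapping.single k 1)"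
      by (intro sum.cong poly_mapping_eqI) (auto simp: lookup_scaleR lookup_single when_def)
    also have "\<dots> \<in> span ?F"
      by (intro span_sum span_scale span_base) auto
    finally show "x \<in> span ?F" .
  qed
qed

lemma dim_cd_orthogonal_sum:
  assumes "subspace S" "S \<subseteq> cd_carrier n" "subspace T" "T \<subseteq> cd_carrier n"
    and orth: "\<And>x y. x \<in> S \<Longrightarrow> y \<in> T \<Longrightarrow> cd_inner n x y = 0"
  shows "dim {x + y |x y. x \<in> S \<and> y \<in> T} = dim S + dim T"
proof -
  obtain F where "finite F" "cd_carrier n \<subseteq> span F"
    by (rule cd_carrier_finite_dim)
  moreover have "S \<inter> T = {0}"
  proof (intro subset_antisym subsetI)
    fix x assume "x \<in> S \<inter> T"
    then have "cd_inner n x x = 0" "x \<in> cd_carrier n"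
      using orth assms(2) by auto
    then show "x \<in> {0}"
      by (simp add: cd_inner_self_eq_0)
  qed (use assms(1,3) in \<open>auto simp: subspace_0\<close>)
  ultimately show ?thesis
    using assms by (intro dim_direct_sum[of S F T F]) auto
qed

section \<open>Complex lines and complex subspaces\<close>

lemma mem_span_pair: "x \<in> span {v, w} \<longleftrightarrow> (\<exists>r s. x = r *\<^sub>R v + s *\<^sub>R w)"
  by (auto simp: span_insert algebra_simps)

lemma cd_C_span1_eq:
  assumes "v \<in> cd_carrier n"
  shows "cd_C_span1 n v = span {v, cd_mult n (cd_i n) v}"
proof -
  have "cd_mult n (r *\<^sub>R cd_one + s *\<^sub>R cd_i n) v = r *\<^sub>R v + s *\<^sub>R cd_mult n (cd_i n) v" for r s
    using assms by simp
  then show ?thesis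
    unfolding cd_C_span1_def set_eq_iff mem_Collect_eq mem_cd_C mem_span_pair by metis
qed

lemma cd_C_subspaceI:
  assumes "V \<subseteq> cd_carrier n" "subspace V" "\<And>x. x \<in> V \<Longrightarrow> cd_mult n (cd_i n) x \<in> V"
  shows "cd_C_subspace n V"
  unfolding cd_C_subspace_def
proof (intro conjI ballI assms(1,2))
  fix c x assume "c \<in> cd_C n" and x: "x \<in> V"
  then obtain r s where "c = r *\<^sub>R cd_one + s *\<^sub>R cd_i n"
    by (auto simp: mem_cd_C)
  then have "cd_mult n c x = r *\<^sub>R x + s *\<^sub>R cd_mult n (cd_i n) x"
    using x assms(1) by auto
  then show "cd_mult n c x \<in> V"
    using assms(2,3) x by (simp add: subspace_add subspace_scale)
qed

lemma cd_C_subspaceD: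
  assumes "cd_C_subspace n V"
  shows "V \<subseteq> cd_carrier n" "subspace V" "x \<in> V \<Longrightarrow> cd_mult n (cd_i n) x \<in> V"
proof -
  show "V \<subseteq> cd_carrier n" "subspace V"
    using assms by (auto simp: cd_C_subspace_def)
  have "cd_i n \<in> cd_C n"
    by (simp add: cd_C_def span_base)
  then show "x \<in> V \<Longrightarrow> cd_mult n (cd_i n) x \<in> V"
    using assms by (auto simp: cd_C_subspace_def)
qed

text \<open>In the absence of associativity the multiples of v need not be stable under C_n for
  formal reasons; stability rests on i_n(i_n v) = -v.\<close>

lemma cd_C_subspace_span1:
  assumes "n \<ge> 1" "v \<in> cd_carrier n"
  shows "cd_C_subspace n (cd_C_span1 n v)"
proof (rule cd_C_subspaceI)
  show "cd_C_span1 n v \<subseteq> cd_carrier n"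
    using assms by (auto simp: cd_C_span1_def)
  show "subspace (cd_C_span1 n v)"
    using assms by (simp add: cd_C_span1_eq)
  show "cd_mult n (cd_i n) x \<in> cd_C_span1 n v" if "x \<in> cd_C_span1 n v" for x
  proof -
    from that obtain r s where "x = r *\<^sub>R v + s *\<^sub>R cd_mult n (cd_i n) v"
      using assms by (auto simp: cd_C_span1_eq mem_span_pair)
    then have "cd_mult n (cd_i n) x = (- s) *\<^sub>R v + r *\<^sub>R cd_mult n (cd_i n) v"
      using assms by (simp add: cd_mult_i_i)
    then show ?thesis
      unfolding cd_C_span1_eq[OF assms(2)] mem_span_pair by blast
  qed
qed

lemma dim_cd_C_span1:
  assumes "n \<ge> 1" "v \<in> cd_carrier n" "v \<noteq> 0"
  shows "dim (cd_C_span1 n v) = 2"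
proof -
  let ?w = "cd_mult n (cd_i n) v"
  have "cd_inner n v ?w = 0"
    using cd_inner_i_commute[OF assms(1,2,2)] by simp
  moreover have "cd_inner n ?w ?w \<noteq> 0" "cd_inner n v v \<noteq> 0"
    using assms by (simp_all add: cd_inner_mult_i(2) cd_inner_self_eq_0)
  ultimately have w: "?w \<notin> span {v}" "?w \<noteq> v"
    by (auto simp: span_singleton)
  have "independent {v, ?w}"
    using w assms(3) independent_insertI[of ?w "{v}"] by (simp add: insert_commute)
  moreover have "cd_C_span1 n v = span {v, ?w}"
    using assms by (simp add: cd_C_span1_eq)
  moreover have "card {v, ?w} = 2"
    using w by simp
  ultimately show ?thesis
    by (simp add: dim_eq_card)
qed

text \<open>V is stable under i_n and i_n is skew, so real orthogonality to v already gives real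
  orthogonality to i_n v. This reduces the Hermitian claims about the summands to real ones about
  generators.\<close>

lemma cd_C_orthogonal_span1:
  assumes "n \<ge> 1" and V: "cd_C_subspace n V" and v: "v \<in> cd_carrier n"
    and orth: "\<And>x. x \<in> V \<Longrightarrow> cd_inner n x v = 0"
  shows "cd_C_orthogonal n V (cd_C_span1 n v)"
  unfolding cd_C_orthogonal_def
proof (intro ballI)
  fix x y assume x: "x \<in> V" and y: "y \<in> cd_C_span1 n v"
  from y obtain r s where y: "y = r *\<^sub>R v + s *\<^sub>R cd_mult n (cd_i n) v"
    using v by (auto simp: cd_C_span1_eq mem_span_pair)
  have "x \<in> cd_carrier n" "cd_mult n (cd_i n) x \<in> V"
    using cd_C_subspaceD[OF V] x by auto
  moreover from this have "cd_inner n x (cd_mult n (cd_i n) v) = 0"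
    using orth cd_inner_mult_i(1)[of n x v] assms(1) v by fastforce
  ultimately show "cd_herm n x y = 0"
    using assms(1) v orth[OF x] by (simp add: y cd_herm_eq_0_iff cd_mult_i_i)
qed

text \<open>The total space is written as a nested binary sum so that the same description also
  suits two applications of \<open>dim_cd_orthogonal_sum\<close>.\<close>

lemma bij_betw_orthogonal_sum:
  assumes V: "subspace V1" "V1 \<subseteq> cd_carrier n" "subspace V2" "V2 \<subseteq> cd_carrier n"
      "subspace V3" "V3 \<subseteq> cd_carrier n"
    and orth: "\<And>x y. x \<in> V1 \<Longrightarrow> y \<in> V2 \<Longrightarrow> cd_inner n x y = 0"
      "\<And>x y. x \<in> V1 \<Longrightarrow> y \<in> V3 \<Longrightarrow> cd_inner n x y = 0"
      "\<And>x y. x \<in> V2 \<Longrightarrow> y \<in> V3 \<Longrightarrow> cd_inner n x y = 0"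
  shows "bij_betw (\<lambda>(x, y, z). x + y + z) (V1 \<times> V2 \<times> V3)
    {x + y |x y. x \<in> {x + y |x y. x \<in> V1 \<and> y \<in> V2} \<and> y \<in> V3}"
proof -
  have "inj_on (\<lambda>(x, y, z). x + y + z) (V1 \<times> V2 \<times> V3)"
  proof (rule inj_onI, clarsimp)
    fix x y z x' y' z'
    assume xyz: "x \<in> V1" "y \<in> V2" "z \<in> V3" "x' \<in> V1" "y' \<in> V2" "z' \<in> V3"
      and eq: "x + y + z = x' + y' + z'"
    let ?x = "x - x'" and ?y = "y - y'" and ?z = "z - z'"
    have in_V: "?x \<in> V1" "?y \<in> V2" "?z \<in> V3"
      using xyz V by (auto intro: subspace_diff)
    then have car: "?x \<in> cd_carrier n" "?y \<in> cd_carrier n" "?z \<in> cd_carrier n"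
      using V by auto
    have 0: "cd_inner n ?x ?y = 0" "cd_inner n ?x ?z = 0" "cd_inner n ?y ?z = 0"
      using orth in_V by blast+
    have "?x + ?y + ?z = 0"
      using eq by (simp add: algebra_simps)
    then have "cd_inner n ?x (?x + ?y + ?z) = 0" "cd_inner n (?x + ?y + ?z) ?y = 0"
      "cd_inner n (?x + ?y + ?z) ?z = 0"
      by (simp_all only: cd_inner_bilinear(1,2))
    then have "cd_inner n ?x ?x = 0" "cd_inner n ?y ?y = 0" "cd_inner n ?z ?z = 0"
      using 0 cd_inner_commute[OF car(2,3)]
      by (simp_all only: cd_inner_bilinear(3,7) add_0 add_0_right)
    then show "x = x' \<and> y = y' \<and> z = z'"
      using car cd_inner_self_eq_0 by fastforce
  qed
  moreover have "(\<lambda>(x, y, z). x + y + z) ` (V1 \<times> V2 \<times> V3) =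
      {x + y |x y. x \<in> {x + y |x y. x \<in> V1 \<and> y \<in> V2} \<and> y \<in> V3}"
    by (fastforce simp: image_iff)
  ultimately show ?thesis
    by (simp add: bij_betw_def)
qed

section \<open>Quotients and annihilators\<close>

lemma cd_perp_plus_C_eq_0:
  assumes "n \<ge> 1" "v \<in> cd_C_perp n"
  shows "v + r *\<^sub>R cd_one + s *\<^sub>R cd_i n = 0 \<longleftrightarrow> v = 0 \<and> r = 0 \<and> s = 0"
proof
  assume 0: "v + r *\<^sub>R cd_one + s *\<^sub>R cd_i n = 0"
  then have "cd_inner n (v + r *\<^sub>R cd_one + s *\<^sub>R cd_i n) cd_one = 0"
    "cd_inner n (v + r *\<^sub>R cd_one + s *\<^sub>R cd_i n) (cd_i n) = 0"
    by (simp_all only: cd_inner_bilinear(1))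
  then have "r = 0" "s = 0"
    using assms by (simp_all add: cd_C_perp_iff cd_inner_i cd_inner_one_one)
  with 0 show "v = 0 \<and> r = 0 \<and> s = 0" by simp
qed simp

lemma cd_mult_eq_iff:
  assumes "n \<ge> 1" "a \<in> cd_C_perp n" "x \<in> cd_C_perp n" "b \<in> cd_C_perp n"
  shows "cd_mult n a x = b \<longleftrightarrow>
    cd_perp_mult n a x = b \<and> cd_inner n a x = 0 \<and> cd_inner n a (cd_mult n (cd_i n) x) = 0"
proof -
  have "cd_mult n a x = b \<longleftrightarrow> (cd_perp_mult n a x - b) + (- cd_inner n a x) *\<^sub>R cd_one
      + (- cd_inner n a (cd_mult n (cd_i n) x)) *\<^sub>R cd_i n = 0"
    by (auto simp: cd_mult_eq_perp_mult[of n a x] algebra_simps)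
  also have "\<dots> \<longleftrightarrow> cd_perp_mult n a x - b = 0 \<and> - cd_inner n a x = 0 \<and>
      - cd_inner n a (cd_mult n (cd_i n) x) = 0"
    using assms by (intro cd_perp_plus_C_eq_0) auto
  finally show ?thesis
    by simp
qed

text \<open>Adjunction gives <aq, a> = |a|^2 <q, 1> and <aq, i_n a> = -|a|^2 <q, i_n>, so the
  C_n-coordinates of q can be read off aq. It serves annihilators (aq = 0) and quotients (aq = b)
  alike.\<close>

lemma cd_mult_C_perp_dividend:
  assumes n: "n \<ge> 1" and a: "a \<in> cd_C_perp n" "a \<noteq> 0" and q: "q \<in> cd_carrier n"
    and b: "cd_inner n (cd_mult n a q) a = 0"
      "cd_inner n (cd_mult n a q) (cd_mult n (cd_i n) a) = 0"
  shows "q \<in> cd_C_perp n"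
proof -
  let ?i = "cd_mult n (cd_i n)"
  have ia: "?i a \<in> cd_C_perp n"
    using n a by simp
  have "cd_inner n a (?i a) = 0"
    using cd_inner_i_commute[OF n, of a a] a by simp
  then have "cd_mult n a a = (- cd_inner n a a) *\<^sub>R cd_one"
    and "cd_mult n a (?i a) = cd_inner n a a *\<^sub>R cd_i n"
    using n a by (simp_all add: cd_mult_eq_perp_mult[of n a] cd_perp_mult_self cd_perp_mult_i cd_mult_i_i)
  moreover have "cd_inner n a a \<noteq> 0"
    using a by (simp add: cd_inner_self_eq_0)
  ultimately show ?thesis
    using b q a ia cd_inner_mult(2)[of a n q]
    by (simp add: cd_C_perp_iff[of q] cd_conj_C_perp)
qed

lemma cd_Ann_C_perp:
  assumes "n \<ge> 1" "a \<in> cd_C_perp n" "a \<noteq> 0" "x \<in> cd_Ann n a"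
  shows "x \<in> cd_C_perp n"
  using assms by (intro cd_mult_C_perp_dividend[of n a x]) (auto simp: cd_Ann_def)

lemma cd_Ann_iff:
  assumes "n \<ge> 1" "a \<in> cd_C_perp n" "x \<in> cd_C_perp n"
  shows "x \<in> cd_Ann n a \<longleftrightarrow>
    cd_perp_mult n a x = 0 \<and> cd_inner n a x = 0 \<and> cd_inner n a (cd_mult n (cd_i n) x) = 0"
  using cd_mult_eq_iff[of n a x 0] assms by (auto simp: cd_Ann_def)

lemma subspace_cd_Ann: "subspace (cd_Ann n a)"
  by (auto simp: subspace_def cd_Ann_def)

text \<open>Stability under i_n comes from describing Ann(a) by P(a,x) = 0 and h(a,x) = 0, both of
  which survive the replacement of x by i_n x.\<close>

lemma cd_C_subspace_Ann:
  assumes "n \<ge> 1" "a \<in> cd_C_perp n" "a \<noteq> 0"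
  shows "cd_C_subspace n (cd_Ann n a)"
proof (intro cd_C_subspaceI subspace_cd_Ann)
  show "cd_Ann n a \<subseteq> cd_carrier n"
    by (auto simp: cd_Ann_def)
  fix x assume x: "x \<in> cd_Ann n a"
  then have "x \<in> cd_C_perp n"
    using assms cd_Ann_C_perp by blast
  then show "cd_mult n (cd_i n) x \<in> cd_Ann n a"
    using assms x by (simp add: cd_Ann_iff cd_perp_mult_i cd_mult_i_i)
qed

text \<open>Left multiplication by a is skew-adjoint, hence maps the orthogonal complement of its kernel
  injectively, and so by finite dimension bijectively, to itself.\<close>

lemma cd_quot:
  assumes n: "n \<ge> 1" and a: "a \<in> cd_C_perp n" and b: "b \<in> cd_carrier n" "cd_orth_to n b (cd_Ann n a)"
  shows "cd_quot n b a \<in> cd_carrier n" "cd_mult n a (cd_quot n b a) = b"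
    "cd_orth_to n (cd_quot n b a) (cd_Ann n a)"
proof -
  let ?S = "{x \<in> cd_carrier n. cd_orth_to n x (cd_Ann n a)}"
  obtain F where F: "finite F" "cd_carrier n \<subseteq> span F"
    by (rule cd_carrier_finite_dim)
  have unique: "x = y" if "x \<in> ?S" "y \<in> ?S" "cd_mult n a x = cd_mult n a y" for x y
  proof -
    have "x - y \<in> cd_Ann n a" "x - y \<in> cd_carrier n"
      using that by (auto simp: cd_Ann_def)
    moreover from this have "cd_inner n x (x - y) = 0" "cd_inner n y (x - y) = 0"
      using that by (simp_all only: cd_orth_to_def mem_Collect_eq)
    then have "cd_inner n (x - y) (x - y) = 0"
      by (simp only: cd_inner_bilinear(4))
    ultimately show "x = y"
      using cd_inner_self_eq_0[of "x - y" n] by (simp del: cd_inner_bilinear)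
  qed
  have "?S \<subseteq> cd_mult n a ` ?S"
  proof (rule subspace_subset_linear_image[where F = F])
    show "linear (cd_mult n a)"
      using bilinear_cd_mult by (simp add: bilinear_def)
    show "subspace ?S"
      by (auto simp: subspace_def cd_orth_to_def)
    show "?S \<subseteq> span F" "finite F"
      using F by auto
    show "inj_on (cd_mult n a) ?S"
      by (rule inj_onI, rule unique)
    show "cd_mult n a ` ?S \<subseteq> ?S"
    proof (rule image_subsetI)
      fix x assume "x \<in> ?S"
      then have x: "x \<in> cd_carrier n"
        by simp
      have "cd_inner n (cd_mult n a x) y = 0" if "y \<in> cd_Ann n a" for y
        using that x a cd_inner_mult(2)[of a n x y] by (simp add: cd_Ann_def cd_conj_C_perp)
      then show "cd_mult n a x \<in> ?S"
        by (simp add: cd_orth_to_def)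
    qed
  qed
  moreover have "b \<in> ?S"
    using b by simp
  ultimately have "b \<in> cd_mult n a ` ?S"
    by (rule subsetD)
  then obtain q where q: "q \<in> ?S" "cd_mult n a q = b"
    by (rule imageE) simp
  have *: "\<exists>!q. q \<in> cd_carrier n \<and> cd_mult n a q = b \<and> cd_orth_to n q (cd_Ann n a)"
  proof (rule ex1I[of _ q])
    show "x = q" if "x \<in> cd_carrier n \<and> cd_mult n a x = b \<and> cd_orth_to n x (cd_Ann n a)" for x
      by (rule unique) (use that q in simp_all)
  qed (use q in simp)
  show "cd_quot n b a \<in> cd_carrier n" "cd_mult n a (cd_quot n b a) = b"
    "cd_orth_to n (cd_quot n b a) (cd_Ann n a)"
    using theI'[OF *] unfolding cd_quot_def by simp_all
qed

text \<open>Write q for b/a. It is C-orthogonal to a because aq = b has no C_n-component, and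
  C-orthogonal to b because b = P(a,q) = -P(q,a). These relations make the scalar terms vanish when
  the third generator is multiplied by {a,b}.\<close>

lemma cd_quot_C_perp:
  assumes n: "n \<ge> 1" and a: "a \<in> cd_C_perp n" "a \<noteq> 0" and b: "b \<in> cd_C_perp n"
    and orth: "cd_orth_to n b (cd_Ann n a)" "cd_inner n b a = 0"
      "cd_inner n b (cd_mult n (cd_i n) a) = 0"
  shows "cd_quot n b a \<in> cd_C_perp n" "cd_perp_mult n a (cd_quot n b a) = b"
    "cd_inner n a (cd_quot n b a) = 0" "cd_inner n a (cd_mult n (cd_i n) (cd_quot n b a)) = 0"
    "cd_inner n b (cd_quot n b a) = 0" "cd_inner n b (cd_mult n (cd_i n) (cd_quot n b a)) = 0"
proof -
  let ?q = "cd_quot n b a"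
  note q = cd_quot[OF n a(1) cd_C_perp_carrier[OF b] orth(1)]
  show V: "?q \<in> cd_C_perp n"
    by (rule cd_mult_C_perp_dividend[OF n a q(1)]) (simp_all only: q(2) orth)
  show P: "cd_perp_mult n a ?q = b" and "cd_inner n a ?q = 0"
    "cd_inner n a (cd_mult n (cd_i n) ?q) = 0"
    using q(2) cd_mult_eq_iff[OF n a(1) V b] by auto
  have "- cd_perp_mult n ?q a = b"
    using P cd_perp_mult_commute[OF n a(1) V] by simp
  moreover have "cd_inner n (- cd_perp_mult n ?q a) ?q = 0"
    "cd_inner n (- cd_perp_mult n ?q a) (cd_mult n (cd_i n) ?q) = 0"
    using cd_inner_perp_mult_self[OF n V a(1)] by simp_all
  ultimately show "cd_inner n b ?q = 0" "cd_inner n b (cd_mult n (cd_i n) ?q) = 0"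
    by simp_all
qed

section \<open>The D-locus and the annihilator of a brace\<close>

lemma cd_brace_C_perp:
  assumes "n \<ge> 1" "x \<in> cd_C_perp n" "y \<in> cd_C_perp n"
  shows "cd_brace n x y \<in> cd_C_perp (Suc n)"
proof -
  have "0 \<in> cd_C n" "cd_one \<in> cd_C n"
    by (auto simp: cd_C_def span_base span_zero)
  then show ?thesis
    using cd_inner_brace_pair_C[OF assms, of cd_one 0] cd_inner_brace_pair_C[OF assms, of 0 cd_one]
    using cd_brace_carrier by (simp add: cd_C_perp_iff cd_i_Suc flip: cd_one_Suc)
qed

lemma cd_brace_inject:
  assumes "n \<ge> 1" "x \<in> cd_C_perp n" "y \<in> cd_C_perp n" "x' \<in> cd_C_perp n" "y' \<in> cd_C_perp n"
    and "cd_brace n x y = cd_brace n x' y'"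
  shows "x = x'" "y = y'"
proof -
  have "cd_brace n (x - x') (y - y') + cd_pair n (0 *\<^sub>R cd_one + 0 *\<^sub>R cd_i n)
      (0 *\<^sub>R cd_one + 0 *\<^sub>R cd_i n) = 0"
    using assms by (simp add: cd_pair_linear(1))
  from cd_brace_plus_pair_eq_0(1,2)[OF assms(1) _ _ this] assms(2-5)
  show "x = x'" "y = y'"
    by simp_all
qed

text \<open>Membership in \<open>cd_D_locus\<close> only supplies some representatives; injectivity
  of the brace identifies them with the given a and b.\<close>

lemma cd_brace_mem_D_locus:
  assumes "n \<ge> 1" "a \<in> cd_C_perp n" "b \<in> cd_C_perp n" "cd_brace n a b \<in> cd_D_locus n"
  shows "cd_inner n a b = 0" "cd_inner n a (cd_mult n (cd_i n) b) = 0"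
    "cd_orth_to n a (cd_Ann n b)" "cd_orth_to n b (cd_Ann n a)"
proof -
  from assms(4) obtain a' b' where ab: "cd_brace n a b = cd_brace n a' b'" "a' \<in> cd_C_perp n"
    "b' \<in> cd_C_perp n" "cd_herm n a' b' = 0" "cd_orth_to n a' (cd_Ann n b')"
    "cd_orth_to n b' (cd_Ann n a')"
    by (auto simp: cd_D_locus_def)
  then have "a' = a" "b' = b"
    using cd_brace_inject assms by metis+
  then show "cd_inner n a b = 0" "cd_inner n a (cd_mult n (cd_i n) b) = 0"
    "cd_orth_to n a (cd_Ann n b)" "cd_orth_to n b (cd_Ann n a)"
    using ab assms by (auto simp: cd_herm_eq_0_iff)
qed

text \<open>Uniqueness of the brace coordinates allows every coordinate of the product to be set to
  zero separately.\<close>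

lemma cd_brace_in_Ann_iff:
  assumes "n \<ge> 1" "a \<in> cd_C_perp n" "b \<in> cd_C_perp n" "x \<in> cd_C_perp n" "y \<in> cd_C_perp n"
  defines "s \<equiv> cd_inner n" and "w \<equiv> \<lambda>u v. cd_inner n u (cd_mult n (cd_i n) v)"
  shows "cd_brace n x y \<in> cd_Ann (Suc n) (cd_brace n a b) \<longleftrightarrow>
    cd_perp_mult n a x = 0 \<and> cd_perp_mult n b y = 0 \<and>
    s a x + s b y = 0 \<and> w a y + w b x = 0 \<and> w a x = w b y \<and> s b x = s a y"
  (is "?A \<longleftrightarrow> ?B")
proof
  let ?P = "cd_perp_mult n"
  assume ?A
  then have "cd_brace n (sqrt 2 *\<^sub>R ?P a x) (sqrt 2 *\<^sub>R ?P b y) +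
    cd_pair n ((- (s a x + s b y)) *\<^sub>R cd_one + (- (w a y + w b x)) *\<^sub>R cd_i n)
      ((w a x - w b y) *\<^sub>R cd_one + (s b x - s a y) *\<^sub>R cd_i n) = 0"
    using cd_mult_brace_brace[OF assms(1-5)] unfolding s_def w_def
    by (simp only: cd_Ann_def mem_Collect_eq cd_brace_linear(5))
  from cd_brace_plus_pair_eq_0[OF assms(1) _ _ this] show ?B
    using assms by simp
next
  assume ?B
  then show ?A
    using cd_mult_brace_brace[OF assms(1-5)] cd_brace_carrier
    unfolding s_def w_def by (simp add: cd_Ann_def cd_pair_linear(1))
qed

lemma cd_mult_i_pair_i:
  assumes "n \<ge> 1"
  shows "cd_mult (Suc n) (cd_i (Suc n)) (cd_pair n 0 (cd_i n)) = cd_pair n (cd_i n) 0"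
  using assms by (simp add: cd_mult_i_pair cd_conj_i)

text \<open>Orthogonality to the complex lines is stated only for their generators and for the real
  product; \<open>cd_C_orthogonal_span1\<close> extends it afterwards. Squared norms are written as
  inner products to avoid square roots.\<close>

lemma cd_Ann_brace_direct_sum:
  fixes n :: nat and a b :: cd
  assumes n: "n \<ge> 1" and a: "a \<in> cd_C_perp n" "a \<noteq> 0" and b: "b \<in> cd_C_perp n" "b \<noteq> 0"
    and D: "cd_brace n a b \<in> cd_D_locus n"
  defines "V1 \<equiv> {cd_brace n x y | x y. x \<in> cd_Ann n a \<and> y \<in> cd_Ann n b}"
    and "w2 \<equiv> cd_brace n (cd_inner n b b *\<^sub>R a) (- (cd_inner n a a *\<^sub>R b))"
    and "w3 \<equiv> cd_brace n (cd_quot n b a) (- cd_quot n a b) + sqrt 2 *\<^sub>R cd_pair n 0 (cd_i n)"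
  shows "cd_C_subspace (Suc n) V1"
    and "w2 \<in> cd_carrier (Suc n)" "w3 \<in> cd_carrier (Suc n)" "w2 \<noteq> 0" "w3 \<noteq> 0"
    and "\<And>v. v \<in> V1 \<Longrightarrow> cd_inner (Suc n) v w2 = 0"
    and "\<And>v. v \<in> V1 \<Longrightarrow> cd_inner (Suc n) v w3 = 0"
    and "\<And>v. v \<in> cd_C_span1 (Suc n) w2 \<Longrightarrow> cd_inner (Suc n) v w3 = 0"
    and "cd_Ann (Suc n) (cd_brace n a b) = {x + y |x y.
      x \<in> {x + y |x y. x \<in> V1 \<and> y \<in> cd_C_span1 (Suc n) w2} \<and> y \<in> cd_C_span1 (Suc n) w3}"
    and "dim V1 = dim (cd_Ann n a) + dim (cd_Ann n b)"
proof -
  let ?i = "cd_mult n (cd_i n)" and ?j = "cd_mult (Suc n) (cd_i (Suc n))"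
  let ?A = "cd_inner n a a" and ?B = "cd_inner n b b"
  let ?q = "cd_quot n b a" and ?r = "cd_quot n a b"
  let ?U = "cd_Ann (Suc n) (cd_brace n a b)"
  note [simp] = n[unfolded One_nat_def] cd_mult_i_C_perp[OF n] a(1) b(1)
  note ab = cd_brace_mem_D_locus[OF n a(1) b(1) D]
  have ba: "cd_inner n b a = 0" "cd_inner n b (?i a) = 0"
    using ab(1,2) cd_inner_commute[of a n b] cd_inner_i_commute[OF n, of a b] by auto
  have i_self: "cd_inner n v (?i v) = 0" if "v \<in> cd_carrier n" for v
    using cd_inner_i_commute[OF n that that] by simp
  have AB: "?A \<noteq> 0" "?B \<noteq> 0"
    using a b by (simp_all add: cd_inner_self_eq_0)
  note q = cd_quot_C_perp[OF n a b(1) ab(4) ba]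
  note r = cd_quot_C_perp[OF n b a(1) ab(3) ab(1,2)]
  have q_Ann: "cd_inner n x ?q = 0" if "x \<in> cd_Ann n a" for x
    using cd_quot(3)[OF n a(1) _ ab(4)] that cd_inner_commute[of x n ?q] q(1)
    by (auto simp: cd_orth_to_def cd_Ann_def)
  have r_Ann: "cd_inner n x ?r = 0" if "x \<in> cd_Ann n b" for x
    using cd_quot(3)[OF n b(1) _ ab(3)] that cd_inner_commute[of x n ?r] r(1)
    by (auto simp: cd_orth_to_def cd_Ann_def)
  have Ann_a: "x \<in> cd_C_perp n" "?i x \<in> cd_Ann n a" "cd_inner n a x = 0" "cd_inner n x a = 0"
    "cd_inner n a (?i x) = 0" "cd_perp_mult n a x = 0" "cd_inner n b x = 0" "cd_inner n b (?i x) = 0"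
    if "x \<in> cd_Ann n a" for x
  proof -
    show x: "x \<in> cd_C_perp n" and ix: "?i x \<in> cd_Ann n a"
      using cd_Ann_C_perp[OF n a that] cd_C_subspaceD(3)[OF cd_C_subspace_Ann[OF n a] that] by auto
    show "cd_inner n a x = 0" "cd_inner n a (?i x) = 0" "cd_perp_mult n a x = 0"
      using cd_Ann_iff[OF n a(1) x] that by auto
    then show "cd_inner n x a = 0"
      using cd_inner_commute[of x n a] x by simp
    \<comment> \<open>The third D-locus condition, applied to x and to i_n x, makes Ann(a)
      C-orthogonal to b.\<close>
    show "cd_inner n b x = 0" "cd_inner n b (?i x) = 0"
      using ab(4) that ix by (auto simp: cd_orth_to_def)
  qed
  have Ann_b: "x \<in> cd_C_perp n" "?i x \<in> cd_Ann n b" "cd_inner n b x = 0" "cd_inner n x b = 0"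
    "cd_inner n b (?i x) = 0" "cd_perp_mult n b x = 0" "cd_inner n a x = 0" "cd_inner n a (?i x) = 0"
    if "x \<in> cd_Ann n b" for x
  proof -
    show x: "x \<in> cd_C_perp n" and ix: "?i x \<in> cd_Ann n b"
      using cd_Ann_C_perp[OF n b that] cd_C_subspaceD(3)[OF cd_C_subspace_Ann[OF n b] that] by auto
    show "cd_inner n b x = 0" "cd_inner n b (?i x) = 0" "cd_perp_mult n b x = 0"
      using cd_Ann_iff[OF n b(1) x] that by auto
    then show "cd_inner n x b = 0"
      using cd_inner_commute[of x n b] x by simp
    show "cd_inner n a x = 0" "cd_inner n a (?i x) = 0"
      using ab(3) that ix by (auto simp: cd_orth_to_def)
  qed
  have iC: "cd_i n \<in> cd_C n" "0 \<in> cd_C n"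
    by (auto simp: cd_C_def span_base span_zero)

  show V1: "cd_C_subspace (Suc n) V1"
  proof (rule cd_C_subspaceI)
    show "V1 \<subseteq> cd_carrier (Suc n)"
      by (auto simp: V1_def)
    show "subspace V1"
      unfolding subspace_def
    proof (intro conjI ballI allI)
      show "0 \<in> V1"
        unfolding V1_def using subspace_0[OF subspace_cd_Ann] cd_brace_linear(1) by force
      fix v assume "v \<in> V1"
      then obtain x y where v: "v = cd_brace n x y" "x \<in> cd_Ann n a" "y \<in> cd_Ann n b"
        by (auto simp: V1_def)
      show "c *\<^sub>R v \<in> V1" for c
        unfolding V1_def v(1) cd_brace_linear(5)[symmetric]
        using v(2,3) subspace_scale[OF subspace_cd_Ann] by blast
      fix v' assume "v' \<in> V1"
      then obtain x' y' where v': "v' = cd_brace n x' y'" "x' \<in> cd_Ann n a" "y' \<in> cd_Ann n b"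
        by (auto simp: V1_def)
      show "v + v' \<in> V1"
        unfolding V1_def v(1) v'(1) cd_brace_linear(2)[symmetric]
        using v(2,3) v'(2,3) subspace_add[OF subspace_cd_Ann] by blast
    qed
    fix v assume "v \<in> V1"
    then obtain x y where v: "v = cd_brace n x y" "x \<in> cd_Ann n a" "y \<in> cd_Ann n b"
      by (auto simp: V1_def)
    have "?j v = cd_brace n (- ?i x) (?i y)"
      using v Ann_a(1) Ann_b(1) by (simp add: cd_mult_i_brace)
    moreover have "- ?i x \<in> cd_Ann n a" "?i y \<in> cd_Ann n b"
      using v Ann_a(2) Ann_b(2) by (simp_all add: subspace_neg[OF subspace_cd_Ann])
    ultimately show "?j v \<in> V1"
      unfolding V1_def by blast
  qed

  show w2: "w2 \<in> cd_carrier (Suc n)" and w3: "w3 \<in> cd_carrier (Suc n)"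
    by (auto simp: w2_def w3_def cd_pair_in_carrier)
  have jw2: "?j w2 = cd_brace n (- (?B *\<^sub>R ?i a)) (- (?A *\<^sub>R ?i b))"
    unfolding w2_def by (subst cd_mult_i_brace) (auto simp del: cd_brace_linear)
  have jw3: "?j w3 = cd_brace n (- ?i ?q) (- ?i ?r) + sqrt 2 *\<^sub>R cd_pair n (cd_i n) 0"
    unfolding w3_def using q(1) r(1) cd_mult_i_brace[OF n q(1), of "- ?r"] cd_mult_i_pair_i[OF n]
    by (simp del: cd_brace_linear)

  show "cd_inner (Suc n) v w2 = 0" if "v \<in> V1" for v
    using that Ann_a(1,4) Ann_b(1,4) by (auto simp: V1_def w2_def cd_inner_brace[OF n])
  show "cd_inner (Suc n) v w3 = 0" if "v \<in> V1" for v
    using that Ann_a(1) Ann_b(1) q(1) r(1) q_Ann r_Ann iC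
    by (auto simp: V1_def w3_def cd_inner_brace[OF n] cd_inner_brace_pair_C[OF n])
  \<comment> \<open>Slot by slot, a is C-orthogonal to b/a and b to a/b; the pair (0, i_n) is
    orthogonal to all braces.\<close>
  have "cd_inner (Suc n) w2 w3 = 0"
    using q(1,3) r(1,3) iC
    by (simp add: w2_def w3_def cd_inner_brace[OF n] cd_inner_brace_pair_C[OF n])
  moreover have "cd_inner (Suc n) (?j w2) w3 = 0"
    using q(1,4) r(1,4) iC unfolding jw2 w3_def
    by (simp add: cd_inner_brace[OF n] cd_inner_brace_pair_C[OF n] cd_inner_mult_i(1) del: cd_brace_linear)
  ultimately show "cd_inner (Suc n) v w3 = 0" if "v \<in> cd_C_span1 (Suc n) w2" for v
    using that w2 by (auto simp: cd_C_span1_eq mem_span_pair)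

  have "w2 \<noteq> 0"
  proof
    assume "w2 = 0"
    then have "cd_inner (Suc n) w2 w2 = 0" by simp
    then have "?B * (?B * ?A) + ?A * (?A * ?B) = 0"
      by (simp add: w2_def cd_inner_brace[OF n] del: cd_brace_linear)
    then have "?A * ?B * (?A + ?B) = 0"
      by (simp add: algebra_simps)
    moreover have "?A > 0" "?B > 0"
      using AB cd_inner_self_nonneg[of a n] cd_inner_self_nonneg[of b n] by auto
    ultimately show False
      by auto
  qed
  then show "w2 \<noteq> 0" .
  show "w3 \<noteq> 0"
  proof
    assume "w3 = 0"
    then have "cd_brace n ?q (- ?r) + cd_pair n (0 *\<^sub>R cd_one + 0 *\<^sub>R cd_i n)
        (0 *\<^sub>R cd_one + sqrt 2 *\<^sub>R cd_i n) = 0"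
      using cd_pair_linear(5)[of n "sqrt 2" 0 "cd_i n"] by (simp add: w3_def)
    from cd_brace_plus_pair_eq_0(6)[OF n _ _ this] q(1) r(1) show False
      by simp
  qed

  have z: "cd_brace n a b \<in> cd_C_perp (Suc n)" "cd_brace n a b \<noteq> 0"
    using cd_brace_C_perp[OF n] cd_brace_inject(1)[OF n, of a b 0 0] a(2) by auto
  then have U: "cd_C_subspace (Suc n) ?U"
    by (intro cd_C_subspace_Ann) auto
  note sub = cd_C_subspaceD(2)[OF U] and jU = cd_C_subspaceD(3)[OF U]

  have V1_U: "v \<in> ?U" if "v \<in> V1" for v
  proof -
    from that obtain x y where v: "v = cd_brace n x y" "x \<in> cd_Ann n a" "y \<in> cd_Ann n b"
      by (auto simp: V1_def)
    then show ?thesis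
      using Ann_a Ann_b by (simp add: cd_brace_in_Ann_iff[OF n])
  qed
  \<comment> \<open>P(a,a) = P(b,b) = 0, <a, i_n a> = <b, i_n b> = 0, and a, b are C-orthogonal.
    What remains is <a,x> + <b,y>, which the weights |b|^2 and -|a|^2 balance to zero.\<close>
  have w2_U: "w2 \<in> ?U"
    unfolding w2_def using ab(1,2) ba i_self[of a] i_self[of b]
    by (subst cd_brace_in_Ann_iff[OF n]) (simp_all add: cd_perp_mult_self)
  have w3_U: "w3 \<in> ?U"
  proof -
    \<comment> \<open>The quotients are C-orthogonal to a and b, so only the brace sqrt 2 {b,-a} is
      left. Since {a,b}(0, i_n) = {-b,a}, this dictates the coefficient sqrt 2 in
      \<open>w3\<close>.\<close>
    have "cd_mult (Suc n) (cd_brace n a b) (cd_brace n ?q (- ?r)) = sqrt 2 *\<^sub>R cd_brace n b (- a)"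
      using q r by (subst cd_mult_brace_brace[OF n]) (simp_all add: cd_pair_linear(1) del: cd_brace_linear)
    moreover have "cd_mult (Suc n) (cd_brace n a b) (cd_pair n 0 (cd_i n)) = cd_brace n (- b) a"
      using cd_mult_brace_pair_C[OF n a(1) b(1), of 0 0 0 1] by simp
    ultimately have "cd_mult (Suc n) (cd_brace n a b) w3 =
        sqrt 2 *\<^sub>R (cd_brace n b (- a) + cd_brace n (- b) a)"
      by (simp add: w3_def scaleR_add_right del: cd_brace_linear)
    also have "\<dots> = 0"
      by (simp add: cd_brace_linear(2)[symmetric] del: cd_brace_linear(2))
    finally show ?thesis
      using w3 by (simp add: cd_Ann_def)
  qed

  show "?U = {x + y |x y. x \<in> {x + y |x y. x \<in> V1 \<and> y \<in> cd_C_span1 (Suc n) w2}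
      \<and> y \<in> cd_C_span1 (Suc n) w3}" (is "_ = ?sum")
  proof (intro subset_antisym subsetI)
    fix z assume "z \<in> ?sum"
    then obtain v1 v2 v3 where "z = v1 + v2 + v3" "v1 \<in> V1"
      "v2 \<in> cd_C_span1 (Suc n) w2" "v3 \<in> cd_C_span1 (Suc n) w3"
      by blast
    moreover have "cd_C_span1 (Suc n) w2 \<subseteq> ?U" "cd_C_span1 (Suc n) w3 \<subseteq> ?U"
      unfolding cd_C_span1_eq[OF w2] cd_C_span1_eq[OF w3]
      using w2_U w3_U jU by (simp_all add: span_minimal[OF _ sub])
    ultimately show "z \<in> ?U"
      by (simp add: V1_U subset_iff subspace_add[OF sub])
  next
    fix z assume z: "z \<in> ?U"
    then have "z \<in> cd_carrier (Suc n)"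
      by (simp add: cd_Ann_def)
    then obtain x y r0 s t u where x: "x \<in> cd_C_perp n" and y: "y \<in> cd_C_perp n"
      and z_eq: "z = cd_brace n x y + cd_pair n (r0 *\<^sub>R cd_one + s *\<^sub>R cd_i n) (t *\<^sub>R cd_one + u *\<^sub>R cd_i n)"
      by (rule cd_brace_plus_pair_C[OF n])
    let ?X = "r0 *\<^sub>R a + t *\<^sub>R ?i a - u *\<^sub>R b - s *\<^sub>R ?i b"
    let ?Y = "u *\<^sub>R a - s *\<^sub>R ?i a + r0 *\<^sub>R b - t *\<^sub>R ?i b"
    have "cd_brace n (sqrt 2 *\<^sub>R cd_perp_mult n a x + ?X) (sqrt 2 *\<^sub>R cd_perp_mult n b y + ?Y) +
      cd_pair n ((- (cd_inner n a x + cd_inner n b y)) *\<^sub>R cd_one + (- (cd_inner n a (?i y) + cd_inner n b (?i x))) *\<^sub>R cd_i n)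
      ((cd_inner n a (?i x) - cd_inner n b (?i y)) *\<^sub>R cd_one + (cd_inner n b x - cd_inner n a y) *\<^sub>R cd_i n)
      = cd_mult (Suc n) (cd_brace n a b) z"
      unfolding z_eq cd_mult_bilinear(2) cd_mult_brace_brace[OF n a(1) b(1) x y]
        cd_mult_brace_pair_C[OF n a(1) b(1)] cd_brace_linear(2)[of n _ ?X] cd_brace_linear(5)
      by (simp only: ac_simps)
    also have "\<dots> = 0"
      using z by (simp add: cd_Ann_def)
    finally have 0: "sqrt 2 *\<^sub>R cd_perp_mult n a x + ?X = 0"
      by (rule cd_brace_plus_pair_eq_0(1)[OF n, rotated 2]) (use x y n in auto)
    \<comment> \<open>P(a,x), b and i_n b are orthogonal to both a and i_n a, so the two equations
      reduce to r0 |a|^2 = 0 and t |a|^2 = 0.\<close>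
    have "cd_inner n (sqrt 2 *\<^sub>R cd_perp_mult n a x + ?X) a = 0"
      "cd_inner n (sqrt 2 *\<^sub>R cd_perp_mult n a x + ?X) (?i a) = 0"
      unfolding 0 by simp_all
    then have rt: "r0 = 0" "t = 0"
      using AB ab(1,2) ba i_self[of a] cd_inner_perp_mult_self[OF n a(1) x]
      by (simp_all add: cd_inner_mult_i cd_mult_i_i)
    \<comment> \<open>The parts of \<open>w3\<close> and of i_{n+1} \<open>w3\<close> outside the
      braces are sqrt 2 (0, i_n) and sqrt 2 (i_n, 0), so these coefficients cancel the remaining
      pair (s i_n, u i_n).\<close>
    let ?z1 = "z - (u / sqrt 2) *\<^sub>R w3 - (s / sqrt 2) *\<^sub>R ?j w3"
    let ?x1 = "x - (u / sqrt 2) *\<^sub>R ?q + (s / sqrt 2) *\<^sub>R ?i ?q"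
    let ?y1 = "y + (u / sqrt 2) *\<^sub>R ?r + (s / sqrt 2) *\<^sub>R ?i ?r"
    \<comment> \<open>Chosen to cancel <a, \<open>?x1\<close>> and <a, i_n \<open>?x1\<close>>: the
      first slots of \<open>w2\<close> and i_{n+1} \<open>w2\<close> are |b|^2 a and -|b|^2 i_n
      a.\<close>
    let ?l = "cd_inner n a ?x1 / (?A * ?B)" and ?m = "cd_inner n a (?i ?x1) / (?A * ?B)"
    let ?z2 = "?z1 - ?l *\<^sub>R w2 - ?m *\<^sub>R ?j w2"
    let ?x2 = "?x1 - (?l * ?B) *\<^sub>R a + (?m * ?B) *\<^sub>R ?i a"
    let ?y2 = "?y1 + (?l * ?A) *\<^sub>R b + (?m * ?A) *\<^sub>R ?i b"
    have z1: "?z1 = cd_brace n ?x1 ?y1"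
    proof -
      have "cd_brace n ?x1 ?y1 = cd_brace n x y - (u / sqrt 2) *\<^sub>R cd_brace n ?q (- ?r)
          - (s / sqrt 2) *\<^sub>R cd_brace n (- ?i ?q) (- ?i ?r)"
        by (simp add: cd_brace_linear(3,5)[symmetric] del: cd_brace_linear)
      moreover have "cd_pair n (s *\<^sub>R cd_i n) (u *\<^sub>R cd_i n) =
         s *\<^sub>R cd_pair n (cd_i n) 0 + u *\<^sub>R cd_pair n 0 (cd_i n)"
        by (simp add: cd_pair_linear(2,5)[symmetric])
      ultimately show ?thesis
        unfolding jw3 unfolding w3_def z_eq rt by (simp add: scaleR_add_right del: cd_brace_linear)
    qed
    have z2: "?z2 = cd_brace n ?x2 ?y2"
      unfolding z1 jw2 unfolding w2_def
      by (simp add: cd_brace_linear(3,5)[symmetric] del: cd_brace_linear)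
    have V: "?x1 \<in> cd_C_perp n" "?y1 \<in> cd_C_perp n" "?x2 \<in> cd_C_perp n" "?y2 \<in> cd_C_perp n"
      using x y q(1) r(1) by simp_all
    have "?z2 \<in> ?U"
      using z w2_U w3_U jU sub by (intro subspace_diff subspace_scale) auto
    from this[unfolded z2 cd_brace_in_Ann_iff[OF n a(1) b(1) V(3,4)]]
    have U2: "cd_perp_mult n a ?x2 = 0" "cd_perp_mult n b ?y2 = 0"
      "cd_inner n a ?x2 + cd_inner n b ?y2 = 0" "cd_inner n a (?i ?x2) = cd_inner n b (?i ?y2)"
      by blast+
    \<comment> \<open>The last two equations of \<open>U2\<close> carry this vanishing over from
      h(a, \<open>?x2\<close>) to h(b, \<open>?y2\<close>).\<close>
    have "cd_inner n a ?x2 = 0" "cd_inner n a (?i ?x2) = 0"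
      using AB V(1) i_self[of a] by (simp_all add: cd_mult_i_i del: cd_brace_linear)
    with U2 have "?x2 \<in> cd_Ann n a" "?y2 \<in> cd_Ann n b"
      using V(3,4) by (simp_all only: cd_Ann_iff[OF n a(1)] cd_Ann_iff[OF n b(1)]) auto
    then have "?z2 \<in> V1"
      unfolding z2 V1_def by blast
    moreover have "?l *\<^sub>R w2 + ?m *\<^sub>R ?j w2 \<in> cd_C_span1 (Suc n) w2"
      "(u / sqrt 2) *\<^sub>R w3 + (s / sqrt 2) *\<^sub>R ?j w3 \<in> cd_C_span1 (Suc n) w3"
      unfolding cd_C_span1_eq[OF w2] cd_C_span1_eq[OF w3] mem_span_pair by blast+
    moreover have "z = ?z2 + (?l *\<^sub>R w2 + ?m *\<^sub>R ?j w2) + ((u / sqrt 2) *\<^sub>R w3 + (s / sqrt 2) *\<^sub>R ?j w3)"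
      by simp
    ultimately show "z \<in> ?sum"
      by blast
  qed

  show "dim V1 = dim (cd_Ann n a) + dim (cd_Ann n b)"
  proof -
    \<comment> \<open>{x,y} = {x,0} + {0,y} exhibits \<open>V1\<close> as an orthogonal sum of
      injective linear images of Ann(a) and Ann(b).\<close>
    let ?f = "\<lambda>x. cd_brace n x 0" and ?g = "\<lambda>y. cd_brace n 0 y"
    have f: "linear ?f" and g: "linear ?g"
      unfolding linear_iff using cd_brace_linear(2)[of n _ _ 0 0] cd_brace_linear(2)[of n 0 0]
        cd_brace_linear(5)[of n _ _ 0] cd_brace_linear(5)[of n _ 0] by simp_all
    have inj: "inj_on ?f (cd_Ann n a)" "inj_on ?g (cd_Ann n b)"
      by (rule inj_onI; rule cd_brace_inject(1)[OF n, of _ 0 _ 0]; simp add: Ann_a(1))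
        (rule inj_onI; rule cd_brace_inject(2)[OF n, of 0 _ 0]; simp add: Ann_b(1))
    have "V1 = {x + y |x y. x \<in> ?f ` cd_Ann n a \<and> y \<in> ?g ` cd_Ann n b}"
    proof -
      have split: "?f x + ?g y = cd_brace n x y" for x y
        using cd_brace_linear(2)[of n x 0 0 y] by simp
      have "V1 = {?f x + ?g y |x y. x \<in> cd_Ann n a \<and> y \<in> cd_Ann n b}"
        unfolding V1_def split ..
      then show ?thesis
        by blast
    qed
    also have "dim \<dots> = dim (?f ` cd_Ann n a) + dim (?g ` cd_Ann n b)"
    proof (rule dim_cd_orthogonal_sum)
      show "subspace (?f ` cd_Ann n a)" "subspace (?g ` cd_Ann n b)"
        using f g subspace_cd_Ann linear_subspace_image by blast+
      show "?f ` cd_Ann n a \<subseteq> cd_carrier (Suc n)" "?g ` cd_Ann n b \<subseteq> cd_carrier (Suc n)"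
        by auto
      show "cd_inner (Suc n) x y = 0" if "x \<in> ?f ` cd_Ann n a" "y \<in> ?g ` cd_Ann n b" for x y
        using that Ann_a(1) Ann_b(1) by (auto simp: cd_inner_brace[OF n])
    qed
    finally show ?thesis
      by (simp add: dim_linear_image_inj f g inj subspace_cd_Ann)
  qed
qed

theorem theorem6p12:
  fixes n :: nat and a b :: cd
  assumes "n \<ge> 1"
    and "a \<in> cd_C_perp n" and "b \<in> cd_C_perp n"
    and "a \<noteq> 0" and "b \<noteq> 0"
    and "cd_brace n a b \<in> cd_D_locus n"
  shows "cd_C_orth_direct_sum (n + 1) (cd_Ann (n + 1) (cd_brace n a b))
           {cd_brace n x y | x y. x \<in> cd_Ann n a \<and> y \<in> cd_Ann n b}
           (cd_C_span1 (n + 1)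
              (cd_brace n ((cd_norm n b)\<^sup>2 *\<^sub>R a) (- ((cd_norm n a)\<^sup>2 *\<^sub>R b))))
           (cd_C_span1 (n + 1)
              (cd_brace n (cd_quot n b a) (- cd_quot n a b) + sqrt 2 *\<^sub>R cd_pair n 0 (cd_i n)))
         \<and> dim (cd_Ann (n + 1) (cd_brace n a b)) = dim (cd_Ann n a) + dim (cd_Ann n b) + 4"
proof -
  define V1 where "V1 = {cd_brace n x y | x y. x \<in> cd_Ann n a \<and> y \<in> cd_Ann n b}"
  define w2 where "w2 = cd_brace n (cd_inner n b b *\<^sub>R a) (- (cd_inner n a a *\<^sub>R b))"
  define w3 where
    "w3 = cd_brace n (cd_quot n b a) (- cd_quot n a b) + sqrt 2 *\<^sub>R cd_pair n 0 (cd_i n)"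
  note main = cd_Ann_brace_direct_sum[OF assms(1,2,4,3,5,6), folded V1_def w2_def w3_def]
  let ?V2 = "cd_C_span1 (Suc n) w2" and ?V3 = "cd_C_span1 (Suc n) w3"
  have V2: "cd_C_subspace (Suc n) ?V2" and V3: "cd_C_subspace (Suc n) ?V3"
    using main(2,3) by (simp_all add: cd_C_subspace_span1)
  have orth: "cd_C_orthogonal (Suc n) V1 ?V2" "cd_C_orthogonal (Suc n) V1 ?V3"
    "cd_C_orthogonal (Suc n) ?V2 ?V3"
    using main V2 by (simp_all add: cd_C_orthogonal_span1)
  note sub = cd_C_subspaceD(1,2)[OF main(1)] cd_C_subspaceD(1,2)[OF V2] cd_C_subspaceD(1,2)[OF V3]
  \<comment> \<open>The bijection and the dimension count use the real inner product, which vanishes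
    with the Hermitian one.\<close>
  have inner: "cd_inner (Suc n) x y = 0"
    if "cd_C_orthogonal (Suc n) V W" "V \<subseteq> cd_carrier (Suc n)" "W \<subseteq> cd_carrier (Suc n)"
      "x \<in> V" "y \<in> W" for V W x y
  proof -
    have "x \<in> cd_carrier (Suc n)" "y \<in> cd_carrier (Suc n)" "cd_herm (Suc n) x y = 0"
      using that by (auto simp: cd_C_orthogonal_def)
    then show ?thesis
      by (simp add: cd_herm_eq_0_iff)
  qed
  let ?V12 = "{x + y |x y. x \<in> V1 \<and> y \<in> ?V2}"
  have "cd_C_orth_direct_sum (Suc n) (cd_Ann (Suc n) (cd_brace n a b)) V1 ?V2 ?V3"
    unfolding cd_C_orth_direct_sum_def main(9)
    using main(1) V2 V3 orth sub inner by (intro conjI bij_betw_orthogonal_sum[where n = "Suc n"]) blast+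
  moreover have "dim (cd_Ann (Suc n) (cd_brace n a b)) = dim (cd_Ann n a) + dim (cd_Ann n b) + 4"
  proof -
    have "dim (cd_Ann (Suc n) (cd_brace n a b)) = dim ?V12 + dim ?V3"
      unfolding main(9)
    proof (rule dim_cd_orthogonal_sum)
      show "subspace ?V12" "?V12 \<subseteq> cd_carrier (Suc n)"
        using sub by (auto intro!: subspace_sums)
      show "cd_inner (Suc n) x y = 0" if x: "x \<in> ?V12" and y: "y \<in> ?V3" for x y
      proof -
        from x obtain v1 v2 where "x = v1 + v2" "v1 \<in> V1" "v2 \<in> ?V2"
          by blast
        then show ?thesis
          using inner[OF orth(2) sub(1,5) _ y] inner[OF orth(3) sub(3,5) _ y] by simp
      qed
    qed (use sub in auto)
    also have "dim ?V12 = dim V1 + dim ?V2"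
      by (rule dim_cd_orthogonal_sum[OF sub(2,1,4,3)]) (rule inner[OF orth(1) sub(1,3)])
    finally show ?thesis
      using main(2-5,10) by (simp add: dim_cd_C_span1)
  qed
  ultimately show ?thesis
    using assms(2,3) by (simp add: V1_def w2_def w3_def cd_norm_power2 del: cd_brace_linear)
qed

end
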